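(* Let $\lambda$ be a partition and $n\ge\ell(\lambda)$. The maps \[\mathrm{mlq}=\rho\circ\mathrm{revcrw}:\ \mathrm{SSYT}(\lambda,n)\to\mathrm{MLQ}_0(\lambda,n),\qquad \mathrm{tab}=\mathrm{Icol}\circ\mathrm{rw}:\ \mathrm{MLQ}_0(\lambda,n)\to\mathrm{SSYT}(\lambda,n)\] are well defined and are mutually inverse bijections.
   Context: Tableaux. Diagrams in French notation (row 1 at the bottom). $\mathrm{SSYT}(\lambda,n)$ is the set of semistandard Young tableaux of shape $\lambda$ (entries weakly increasing along rows left to right, strictly increasing up columns) with entries in $[n]$. The column reading word $\mathrm{crw}(T)$ reads the columns from left to right, each column from top to bottom; $\mathrm{revcrw}(T)$ is its reverse. For a word $w=w_1\cdots w_k$, $\mathrm{Icol}(w)=w_k\to(\cdots\to(w_2\to(w_1\to\emptyset))\cdots)$ is the tableau obtained by successive Schensted column insertion of $w_1,w_2,\dots,w_k$ into the empty tableau. Multiline queues. For a partition $\lambda$ with $L=\lambda_1$, $\mathrm{MLQ}(\lambda,n)$ is the set of tuples $M=(B_1,\dots,B_L)$ of subsets of $[n]$ with $|B_j|=\lambda'_j$ ($\lambda'$ the conjugate), drawn with rows $1..L$ bottom to top, columns $1..n$ left to right, ball in $(r,j)$ iff $j\in B_r$. Tuples with empty top rows are identified with the tuple obtained by deleting them. The column word $\mathrm{cw}(M)$ scans columns left to right, each top to bottom, recording row numbers of balls; the row word $\mathrm{rw}(M)$ scans rows bottom to top, each row left to right, recording column numbers of balls. Major index: for $r=L,\dots,2$,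 unlabelled balls of row $r$ get label $r$; then balls of row $r$ in decreasing label order (left to right among ties) are each paired with the first unlabelled ball of row $r-1$ weakly to the right, cyclically modulo $n$, which gets the same label; a pairing wraps if the lower ball is strictly left of the upper ball. $\operatorname{maj}(M)=\sum(\ell(p)-r(p)+1)$ over wrapping pairings ($r(p)$ upper row, $\ell(p)$ label). $\mathrm{MLQ}_0(\lambda,n)=\{M:\operatorname{maj}(M)=0\}$. Collapsing and insertion. For a word $w$ and $i\ge1$, $\mathrm{Par}_i(w)$ writes "(" for each $i+1$ and ")" for each $i$ and iteratively matches a "(" with a ")" to its right when adjacent or separated only by matched parentheses. For $B=(B_1,\dots,B_K)$ a tuple of subsets of $[n]$, $e_i^\star(B)$ moves every ball of row $i+1$ whose letter in $\mathrm{cw}(B)$ is unmatched in $\mathrm{Par}_i(\mathrm{cw}(B))$ down to row $i$ in the same column; $e^\star_{[a,b]}=e^\star_ae^\star_{a+1}\cdots e^\star_b$ (acting right to left) and $\rho_N(B)=e^\star_{[1,K-1]}\cdots e^\star_{[1,1]}(B)$. For a word $w=w_1\cdots w_k$ in $[n]$, $\rho(w)=\rho_N(\{w_1\},\{w_2\},\dots,\{w_k\})$. *)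

theory Defs
  imports Main
begin

definition is_partition :: "nat list \<Rightarrow> bool" where
  "is_partition lam \<longleftrightarrow> sorted_wrt (\<ge>) lam \<and> (\<forall>x\<in>set lam. 0 < x)"

definition conj_part :: "nat list \<Rightarrow> nat list" where
  "conj_part lam = map (\<lambda>j. length (filter (\<lambda>x. j < x) lam))
                       [0..<(if lam = [] then 0 else hd lam)]"

section \<open>Tableaux (list of rows, row 1 first = bottom row in French notation)\<close>

definition SSYT :: "nat list \<Rightarrow> nat \<Rightarrow> nat list list set" where
  "SSYT lam n = {T. map length T = lam
      \<and> (\<forall>row\<in>set T. sorted row \<and> set row \<subseteq> {1..n})
      \<and> (\<forall>i j. Suc i < length T \<longrightarrow> j < length (T ! Suc i) \<longrightarrow> T ! i ! j < T ! Suc i ! j)}"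

definition crw :: "nat list list \<Rightarrow> nat list" where
  "crw T = concat (map (\<lambda>j. rev [T ! i ! j. i \<leftarrow> [0..<length T], j < length (T ! i)])
                        [0..<(if T = [] then 0 else length (hd T))])"

definition revcrw :: "nat list list \<Rightarrow> nat list" where
  "revcrw T = rev (crw T)"

text \<open>Schensted column insertion, on tableaux stored as lists of columns
  (column 1 first, each column bottom to top, strictly increasing).
  x bumps the smallest entry >= x of the column into the next column, or
  is placed on top of the column if there is none.\<close>
fun col_insert :: "nat \<Rightarrow> nat list list \<Rightarrow> nat list list" where
  "col_insert x [] = [[x]]"
| "col_insert x (c # cs) =
     (let k = length (takeWhile (\<lambda>y. y < x) c) in
      if k = length c then (c @ [x]) # cs
      else (c[k := x]) # col_insert (c ! k) cs)"

definition cols_to_rows :: "nat list list \<Rightarrow> nat list list" where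
  "cols_to_rows cs = map (\<lambda>i. [c ! i. c \<leftarrow> cs, i < length c])
                         [0..<(if cs = [] then 0 else length (hd cs))]"

definition Icol :: "nat list \<Rightarrow> nat list list" where
  "Icol w = cols_to_rows (foldl (\<lambda>T x. col_insert x T) [] w)"

section \<open>Multiline queues (list of rows B_1,...,B_K; B_r = set of columns of balls of row r)\<close>

text \<open>Identification of tuples differing by empty top rows: delete them.\<close>
definition strip_top :: "nat set list \<Rightarrow> nat set list" where
  "strip_top M = rev (dropWhile (\<lambda>B. B = {}) (rev M))"

definition MLQ :: "nat list \<Rightarrow> nat \<Rightarrow> nat set list set" where
  "MLQ lam n = {M. length M = length (conj_part lam)
      \<and> (\<forall>r<length M. M ! r \<subseteq> {1..n} \<and> card (M ! r) = conj_part lam ! r)}"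

definition cw_pos :: "nat set list \<Rightarrow> (nat \<times> nat) list" where
  "cw_pos M = concat (map (\<lambda>j. map (\<lambda>r. (r, j))
                  (filter (\<lambda>r. j \<in> M ! (r - 1)) (rev [1..<Suc (length M)])))
              (sorted_list_of_set (\<Union> (set M))))"

definition cw :: "nat set list \<Rightarrow> nat list" where
  "cw M = map fst (cw_pos M)"

definition rw :: "nat set list \<Rightarrow> nat list" where
  "rw M = concat (map sorted_list_of_set M)"

text \<open>Pair the balls (label, column) of an upper row r (already in processing order)
  with the balls of the lower row Blow; accumulate lower labels and the maj contribution.\<close>
fun pair_row :: "nat \<Rightarrow> nat set \<Rightarrow> (nat \<times> nat) list \<Rightarrow> (nat \<Rightarrow> nat option) \<Rightarrow> nat
                  \<Rightarrow> (nat \<Rightarrow> nat option) \<times> nat" where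
  "pair_row r Blow [] lab m = (lab, m)"
| "pair_row r Blow ((l, j) # ps) lab m =
     (let free = {c \<in> Blow. lab c = None};
          t = (if \<exists>c\<in>free. j \<le> c then Min {c \<in> free. j \<le> c} else Min free)
      in pair_row r Blow ps (lab(t := Some l)) (if t < j then m + (l + 1 - r) else m))"

definition maj_step :: "nat set list \<Rightarrow> nat \<Rightarrow> (nat \<Rightarrow> nat option) \<times> nat
                          \<Rightarrow> (nat \<Rightarrow> nat option) \<times> nat" where
  "maj_step M r st =
     (let B = M ! (r - 1);
          lab = (\<lambda>j. if j \<in> B \<and> fst st j = None then Some r else fst st j);
          ps = concat (map (\<lambda>l. map (\<lambda>j. (l, j)) (sorted_list_of_set {j \<in> B. lab j = Some l}))
                           (rev [r..<Suc (length M)]))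
      in pair_row r (M ! (r - 2)) ps Map.empty (snd st))"

definition maj :: "nat set list \<Rightarrow> nat" where
  "maj M = snd (foldl (\<lambda>st r. maj_step M r st) (Map.empty, 0) (rev [2..<Suc (length M)]))"

definition MLQ0 :: "nat list \<Rightarrow> nat \<Rightarrow> nat set list set" where
  "MLQ0 lam n = {M \<in> MLQ lam n. maj M = 0}"

text \<open>Bracket matching for Par_i: "(" = letter i+1, ")" = letter i. Scanning left to right,
  a ")" matches the nearest unmatched "(" to its left (equivalent to the iterative
  matching). Returns the columns of the unmatched "(" (balls of row i+1).\<close>
fun par_unmatched :: "nat \<Rightarrow> (nat \<times> nat) list \<Rightarrow> nat list \<Rightarrow> nat list" where
  "par_unmatched i [] st = st"
| "par_unmatched i ((r, j) # ps) st =
     (if r = Suc i then par_unmatched i ps (j # st)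
      else if r = i then par_unmatched i ps (drop 1 st)
      else par_unmatched i ps st)"

definition estar :: "nat \<Rightarrow> nat set list \<Rightarrow> nat set list" where
  "estar i M = (let U = set (par_unmatched i (cw_pos M) [])
                in M[i := M ! i - U, i - 1 := M ! (i - 1) \<union> U])"

definition estar_int :: "nat \<Rightarrow> nat \<Rightarrow> nat set list \<Rightarrow> nat set list" where
  "estar_int a b M = foldr estar [a..<Suc b] M"

definition rhoN :: "nat set list \<Rightarrow> nat set list" where
  "rhoN B = foldl (\<lambda>M m. estar_int 1 m M) B [1..<length B]"

definition rho :: "nat list \<Rightarrow> nat set list" where
  "rho w = rhoN (map (\<lambda>x. {x}) w)"

definition mlq :: "nat list list \<Rightarrow> nat set list" where
  "mlq T = strip_top (rho (revcrw T))"

definition tab :: "nat set list \<Rightarrow> nat list list" where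
  "tab M = Icol (rw M)"

end

theory Submission
  imports Defs "HOL-Library.Multiset"
begin

text \<open>
  Rows of balls and columns of tableaux are both encoded as states \<open>X :: nat \<Rightarrow> nat set\<close>. Besides the
  collapsing operator \<open>opE i\<close>, which moves the unmatched balls of row \<open>i + 1\<close> down, consider its partner
  \<open>opF i\<close>, which moves the unmatched balls of row \<open>i\<close> up; inserting a set into a column by Schensted
  column insertion is exactly one application of \<open>opF\<close>. In terms of prefix counts both operators are
  Pitman transforms, and one max-plus identity shows that each family satisfies the 0-Hecke relations
  and that \<open>opE i \<circ> opF i = opE i\<close>, \<open>opF i \<circ> opE i = opF i\<close>. A longest word in either family therefore absorbs
  all generators of both, so the longest words \<open>W\<^sub>E\<close> and \<open>W\<^sub>F\<close> satisfy \<open>W\<^sub>E W\<^sub>F = W\<^sub>E\<close> and \<open>W\<^sub>F W\<^sub>E = W\<^sub>F\<close>.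
  Now \<open>\<rho>\<close> is \<open>W\<^sub>E\<close>, column insertion of the row word is \<open>W\<^sub>F\<close> (columns listed from right to left),
  the fixed points of the \<open>opE i\<close> are the queues of major index 0, and those of the \<open>opF i\<close> are the
  columns of semistandard tableaux. The shape is preserved because both families can only increase the
  sum of the squares of the row sizes, and going back and forth returns to the start.
\<close>

section \<open>Pitman transforms of prefix counts\<close>

text \<open>A single \<open>opE\<close> or \<open>opF\<close> is idempotent and in general not
  injective; only a whole longest word can be undone, because every further letter on either side of
  it disappears. The same absorption settles the start of \<open>rho\<close>, which has one ball per
  row: merging an increasing run of one-ball rows into one row is itself a sequence of
  \<open>opE\<close> moves, so the longest word cannot tell the letters of a row word from its rows.
  Reversing the columns and exchanging the two rows swaps the families, so the relations are
  computed for \<open>opF\<close> and reflected to \<open>opE\<close>. Reflection needs a finite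
  width, which is why states are confined to \<open>{..<N}\<close>. Tableau columns are listed from
  right to left because a new row meets the first column first: placed at the next free index, it is
  the neighbour of that column, and the bumped entries travel to lower indices.\<close>

definition rmax :: "(nat \<Rightarrow> int) \<Rightarrow> nat \<Rightarrow> nat \<Rightarrow> int" where
  "rmax f r t = Max (f ` {r..t})"

lemma rmax_ge: "r \<le> s \<Longrightarrow> s \<le> t \<Longrightarrow> f s \<le> rmax f r t"
  by (simp add: rmax_def)

lemma rmax_attained:
  assumes "r \<le> t"
  obtains s where "r \<le> s" "s \<le> t" "rmax f r t = f s"
proof -
  have "rmax f r t \<in> f ` {r..t}"
    unfolding rmax_def using assms by (intro Max_in) auto
  then show ?thesis using that by auto
qed

lemma rmax_le_iff: "r \<le> t \<Longrightarrow> rmax f r t \<le> c \<longleftrightarrow> (\<forall>s\<in>{r..t}. f s \<le> c)"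
  by (simp add: rmax_def)

lemma rmax_same [simp]: "rmax f r r = f r"
  by (simp add: rmax_def)

lemma rmax_Suc: "r \<le> t \<Longrightarrow> rmax f r (Suc t) = max (rmax f r t) (f (Suc t))"
  by (simp add: rmax_def atLeastAtMostSuc_conv max.commute)

lemma rmax_mono: "s \<le> t \<Longrightarrow> r \<le> s \<Longrightarrow> rmax f r s \<le> rmax f r t"
  by (auto simp: rmax_le_iff intro: rmax_ge)

text \<open>Up-steps of size at most one cannot skip a level, so the least time at which
  \<open>D\<close> is at least \<open>c\<close> hits \<open>c\<close> exactly.\<close>

lemma first_visit:
  fixes D :: "nat \<Rightarrow> int"
  assumes step: "\<And>j. D (Suc j) \<le> D j + 1" and "r \<le> m" "D r \<le> c" "c \<le> D m"
  obtains s where "r \<le> s" "s \<le> m" "D s = c" "\<forall>y. r \<le> y \<and> y < s \<longrightarrow> D y < c"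
proof -
  define s where "s = (LEAST s. r \<le> s \<and> c \<le> D s)"
  have s: "r \<le> s" "c \<le> D s" "s \<le> m"
    using LeastI[of "\<lambda>s. r \<le> s \<and> c \<le> D s" m] Least_le[of "\<lambda>s. r \<le> s \<and> c \<le> D s" m] assms
    by (auto simp: s_def)
  have less: "\<forall>y. r \<le> y \<and> y < s \<longrightarrow> D y < c"
    using not_less_Least[of _ "\<lambda>s. r \<le> s \<and> c \<le> D s"] by (fastforce simp: s_def not_le)
  have "D s = c"
  proof (cases "s = r")
    case True
    then show ?thesis using s assms(3) by simp
  next
    case False
    then obtain s' where s': "s = Suc s'" "r \<le> s'" using s(1) by (cases s) auto
    then have "D s' < c" using less by auto
    then show ?thesis using step[of s'] s(2) s' by auto
  qed
  then show ?thesis using that s less by blast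
qed

text \<open>The two-line last passage values from \<open>r\<close> to \<open>t\<close> are invariant under the Pitman transform
  \<open>D \<mapsto> D - 2M\<close>.\<close>

lemma rmax_pitman:
  fixes D :: "nat \<Rightarrow> int"
  assumes step: "\<And>j. D (Suc j) \<le> D j + 1" and "r \<le> t"
  shows "rmax (\<lambda>s. D s - 2 * rmax D 0 s) r t + rmax D 0 r + rmax D 0 t = rmax D r t"
proof (rule antisym)
  let ?M = "rmax D 0"
  obtain s where s: "r \<le> s" "s \<le> t" "rmax (\<lambda>s. D s - 2 * ?M s) r t = D s - 2 * ?M s"
    using rmax_attained[OF \<open>r \<le> t\<close>] by blast
  obtain m where m: "m \<le> t" "?M t = D m" using rmax_attained[of 0 t D] by auto
  have ds: "D s \<le> rmax D r t" using rmax_ge s by blast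
  have rs: "?M r \<le> ?M s" using s by (simp add: rmax_mono)
  have "D s - 2 * ?M s + ?M r + ?M t \<le> rmax D r t"
  proof (cases "m \<le> s")
    case True
    then have "?M t \<le> ?M s" using m by (simp add: rmax_ge)
    then show ?thesis using rs ds by linarith
  next
    case False
    then have "?M t \<le> rmax D r t" using m s rmax_ge[of r m t D] by simp
    moreover have "D s \<le> ?M s" by (simp add: rmax_ge)
    ultimately show ?thesis using rs by linarith
  qed
  then show "rmax (\<lambda>s. D s - 2 * ?M s) r t + ?M r + ?M t \<le> rmax D r t" using s by simp
next
  let ?M = "rmax D 0"
  obtain m where m: "r \<le> m" "m \<le> t" "rmax D r t = D m" using rmax_attained[OF \<open>r \<le> t\<close>] by blast
  obtain x where x: "x \<le> t" "?M t = D x" using rmax_attained[of 0 t D] by auto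
  have *: "D s - 2 * ?M s \<le> rmax (\<lambda>s. D s - 2 * ?M s) r t" if "r \<le> s" "s \<le> t" for s
    using rmax_ge[OF that, of "\<lambda>s. D s - 2 * ?M s"] by simp
  show "rmax D r t \<le> rmax (\<lambda>s. D s - 2 * ?M s) r t + ?M r + ?M t"
  proof (cases "D m \<le> ?M r")
    case True
    have "?M m \<le> ?M r"
    proof -
      have "D y \<le> ?M r" if "y \<le> m" for y
      proof (cases "y \<le> r")
        case False
        then have "D y \<le> rmax D r t" using that m rmax_ge[of r y t D] by simp
        then show ?thesis using m True by simp
      qed (simp add: rmax_ge)
      then show ?thesis by (simp add: rmax_le_iff)
    qed
    moreover have "?M m \<le> ?M t" using m by (simp add: rmax_mono)
    ultimately show ?thesis using *[OF m(1,2)] m by linarith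
  next
    case False
    \<comment> \<open>Here \<open>D\<close> exceeds its earlier maximum \<open>?M r\<close> inside
      the interval. At the first time \<open>s\<close> at which it reaches that level no record has
      been broken since \<open>r\<close>, so \<open>D s - 2 * ?M s\<close> is at least
      \<open>- ?M r\<close>, and \<open>?M t\<close> accounts for the rest.\<close>
    have "D r \<le> ?M r" by (simp add: rmax_ge)
    then obtain s where s: "r \<le> s" "s \<le> m" "D s = ?M r" "\<forall>y. r \<le> y \<and> y < s \<longrightarrow> D y < ?M r"
      using first_visit[of D, OF step m(1), of "?M r"] False by auto
    have "?M s \<le> ?M r"
    proof -
      have "D y \<le> ?M r" if "y \<le> s" for y
      proof (cases "y \<le> r")
        case False
        then show ?thesis using that s(3) s(4)[rule_format, of y] by (cases "y = s") auto
      qed (simp add: rmax_ge)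
      then show ?thesis by (simp add: rmax_le_iff)
    qed
    moreover have "D m \<le> ?M t" using m by (simp add: rmax_ge)
    moreover have "s \<le> t" using s m by simp
    ultimately show ?thesis using *[OF s(1)] s m by fastforce
  qed
qed

text \<open>\<open>up f g t\<close> is the maximum of \<open>f s + g t - g s\<close> over
  \<open>s \<le> t\<close>, the last passage value of a path that switches once from line
  \<open>f\<close> to line \<open>g\<close>; \<open>dn\<close> is the corresponding minimum.\<close>

definition up :: "(nat \<Rightarrow> int) \<Rightarrow> (nat \<Rightarrow> int) \<Rightarrow> nat \<Rightarrow> int" where
  "up f g t = g t + rmax (\<lambda>s. f s - g s) 0 t"

definition dn :: "(nat \<Rightarrow> int) \<Rightarrow> (nat \<Rightarrow> int) \<Rightarrow> nat \<Rightarrow> int" where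
  "dn f g t = g t - rmax (\<lambda>s. g s - f s) 0 t"

text \<open>Unfolding both levels writes \<open>up (up u p) q t\<close> as a maximum over
  \<open>r \<le> s \<le> t\<close>. For fixed \<open>r\<close> the maximum over \<open>s\<close> is
  a two-line passage value from \<open>r\<close> to \<open>t\<close>, and on these values the pairs
  \<open>p\<close>, \<open>q\<close> and \<open>v\<close>, \<open>w\<close> agree by
  assumption.\<close>

lemma up_up_le:
  assumes "\<And>r. r \<le> t \<Longrightarrow> rmax (\<lambda>s. p s - q s) r t - p r + q t = rmax (\<lambda>s. v s - w s) r t - v r + w t"
  shows "up (up u p) q t \<le> up (up u v) w t"
proof -
  obtain s where s: "s \<le> t" "up (up u p) q t = q t + (up u p s - q s)"
    unfolding up_def[of "up u p" q] using rmax_attained[of 0 t "\<lambda>s. up u p s - q s"] by auto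
  obtain r where r: "r \<le> s" "up u p s = p s + (u r - p r)"
    unfolding up_def[of u p] using rmax_attained[of 0 s "\<lambda>s. u s - p s"] by auto
  have rt: "r \<le> t" using r s by simp
  obtain s' where s': "r \<le> s'" "s' \<le> t" "rmax (\<lambda>s. v s - w s) r t = v s' - w s'"
    using rmax_attained[OF rt] by blast
  have "p s - q s \<le> rmax (\<lambda>s. p s - q s) r t"
    using rmax_ge[OF r(1) s(1), of "\<lambda>s. p s - q s"] by simp
  then have "up (up u p) q t \<le> u r - v r + w t + v s' - w s'"
    using assms[OF rt] s r s' by linarith
  moreover have "u r - v r + v s' \<le> up u v s'"
    unfolding up_def using rmax_ge[of 0 r s' "\<lambda>s. u s - v s"] s' by simp
  moreover have "w t + (up u v s' - w s') \<le> up (up u v) w t"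
    unfolding up_def[of "up u v" w] using rmax_ge[of 0 s' t "\<lambda>s. up u v s - w s"] s' by simp
  ultimately show ?thesis by linarith
qed

lemma up_up_eq:
  assumes "\<And>r. r \<le> t \<Longrightarrow> rmax (\<lambda>s. p s - q s) r t - p r + q t = rmax (\<lambda>s. v s - w s) r t - v r + w t"
  shows "up (up u p) q t = up (up u v) w t"
  by (intro antisym up_up_le assms assms[symmetric])

lemma dn_up: "dn f g t = - up (\<lambda>s. - f s) (\<lambda>s. - g s) t"
  by (simp add: dn_def up_def)

text \<open>The pair \<open>dn w v\<close>, \<open>up v w\<close> is the Pitman transform of
  \<open>v\<close>, \<open>w\<close>: its difference is \<open>D - 2 M\<close> for
  \<open>D = v - w\<close> with running maximum \<open>M\<close>, so the passage values from every
  \<open>r\<close> are unchanged.\<close>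

lemma up_braid:
  assumes "\<And>j. v (Suc j) - w (Suc j) \<le> v j - w j + 1"
  shows "up (up u (dn w v)) (up v w) t = up (up u v) w t"
proof (rule up_up_eq)
  fix r assume "r \<le> t"
  have e: "(\<lambda>s. dn w v s - up v w s) = (\<lambda>s. (v s - w s) - 2 * rmax (\<lambda>s. v s - w s) 0 s)"
    by (auto simp: dn_def up_def)
  show "rmax (\<lambda>s. dn w v s - up v w s) r t - dn w v r + up v w t = rmax (\<lambda>s. v s - w s) r t - v r + w t"
    unfolding e using rmax_pitman[of "\<lambda>s. v s - w s", OF assms \<open>r \<le> t\<close>] by (simp add: dn_def up_def)
qed

text \<open>Negation turns \<open>dn\<close> into \<open>up\<close>; the transformed pair is now
  \<open>u\<close>, \<open>v\<close>, with \<open>D = u - v\<close>.\<close>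

lemma dn_braid:
  assumes "\<And>j. u (Suc j) - v (Suc j) \<le> u j - v j + 1"
  shows "dn (dn w (up u v)) (dn v u) t = dn (dn w v) u t"
proof -
  have "up (up (\<lambda>s. - w s) (\<lambda>s. - up u v s)) (\<lambda>s. - dn v u s) t = up (up (\<lambda>s. - w s) (\<lambda>s. - v s)) (\<lambda>s. - u s) t"
  proof (rule up_up_eq)
    fix r assume "r \<le> t"
    have e: "(\<lambda>s. - up u v s - - dn v u s) = (\<lambda>s. (u s - v s) - 2 * rmax (\<lambda>s. u s - v s) 0 s)"
      by (auto simp: dn_def up_def)
    have e': "(\<lambda>s. - v s - - u s) = (\<lambda>s. u s - v s)" by auto
    show "rmax (\<lambda>s. - up u v s - - dn v u s) r t - - up u v r + - dn v u t
       = rmax (\<lambda>s. - v s - - u s) r t - - v r + - u t"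
      unfolding e e' using rmax_pitman[of "\<lambda>s. u s - v s", OF assms \<open>r \<le> t\<close>] by (simp add: dn_def up_def)
  qed
  then show ?thesis by (simp add: dn_up)
qed

section \<open>Bracket matching as records of a height path\<close>

definition pcount :: "nat set \<Rightarrow> nat \<Rightarrow> int" where
  "pcount a j = int (card (a \<inter> {..<j}))"

definition hgt :: "nat set \<Rightarrow> nat set \<Rightarrow> nat \<Rightarrow> int" where
  "hgt a b j = pcount a j - pcount b j"

lemma pcount_0 [simp]: "pcount a 0 = 0"
  by (simp add: pcount_def)

lemma pcount_Suc: "pcount a (Suc j) = pcount a j + (if j \<in> a then 1 else 0)"
proof -
  have "a \<inter> {..<Suc j} = (if j \<in> a then insert j (a \<inter> {..<j}) else a \<inter> {..<j})"
    by (auto simp: less_Suc_eq)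
  then show ?thesis by (simp add: pcount_def)
qed

lemma pcount_inject: "pcount a = pcount b \<Longrightarrow> a = b"
proof (intro set_eqI)
  fix j assume "pcount a = pcount b"
  then have "pcount a (Suc j) = pcount b (Suc j)" "pcount a j = pcount b j" by auto
  then show "j \<in> a \<longleftrightarrow> j \<in> b" by (auto simp: pcount_Suc split: if_splits)
qed

lemma pcount_Un: "a \<inter> b = {} \<Longrightarrow> pcount (a \<union> b) j = pcount a j + pcount b j"
  by (induction j) (auto simp: pcount_Suc)

lemma pcount_Diff: "b \<subseteq> a \<Longrightarrow> pcount (a - b) j = pcount a j - pcount b j"
  by (induction j) (auto simp: pcount_Suc)

lemma pcount_mono: "i \<le> j \<Longrightarrow> pcount a i \<le> pcount a j"
  by (induction j) (auto simp: pcount_Suc le_Suc_eq)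

lemma pcount_eq_card: "finite a \<Longrightarrow> a \<subseteq> {..<N} \<Longrightarrow> N \<le> j \<Longrightarrow> pcount a j = int (card a)"
  unfolding pcount_def by (rule arg_cong[of _ _ "\<lambda>s. int (card s)"]) auto

lemma hgt_0 [simp]: "hgt a b 0 = 0"
  by (simp add: hgt_def)

lemma hgt_Suc: "hgt a b (Suc j) = hgt a b j + (if j \<in> a then 1 else 0) - (if j \<in> b then 1 else 0)"
  by (simp add: hgt_def pcount_Suc)

text \<open>In the bracket word with an opening bracket for each element of \<open>b\<close> and a closing one for each
  element of \<open>a\<close> (the opening one first within a column), \<open>unm_close a b\<close> and \<open>unm_open a b\<close>
  are the columns of the unmatched closing and opening brackets.\<close>

definition unm_close :: "nat set \<Rightarrow> nat set \<Rightarrow> nat set" where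
  "unm_close a b = {j. \<forall>y\<le>j. hgt a b y < hgt a b (Suc j)}"

definition unm_open :: "nat set \<Rightarrow> nat set \<Rightarrow> nat set" where
  "unm_open a b = {j. \<forall>y>j. hgt a b y < hgt a b j}"

lemma unm_close_subset: "unm_close a b \<subseteq> a" "unm_close a b \<inter> b = {}"
  unfolding unm_close_def using hgt_Suc[of a b] by (fastforce split: if_splits)+

lemma unm_open_subset: "unm_open a b \<subseteq> b" "unm_open a b \<inter> a = {}"
proof -
  have "j \<in> b \<and> j \<notin> a" if "j \<in> unm_open a b" for j
  proof -
    have "hgt a b (Suc j) < hgt a b j" using that by (simp add: unm_open_def)
    then show ?thesis by (auto simp: hgt_Suc split: if_splits)
  qed
  then show "unm_open a b \<subseteq> b" "unm_open a b \<inter> a = {}" by auto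
qed

text \<open>An unmatched closing bracket is a new record of the height path. Since the path climbs
  by at most one per column, each record raises the running maximum by exactly one.\<close>

lemma pcount_unm_close: "pcount (unm_close a b) j = rmax (hgt a b) 0 j"
proof (induction j)
  case (Suc j)
  have "j \<in> unm_close a b \<longleftrightarrow> rmax (hgt a b) 0 j < hgt a b (Suc j)"
  proof -
    obtain s where s: "s \<le> j" "rmax (hgt a b) 0 j = hgt a b s" using rmax_attained[of 0 j "hgt a b"] by auto
    show ?thesis
    proof
      assume "rmax (hgt a b) 0 j < hgt a b (Suc j)"
      then show "j \<in> unm_close a b"
        using rmax_ge[of 0 _ j "hgt a b"] by (fastforce simp: unm_close_def)
    qed (use s in \<open>auto simp: unm_close_def\<close>)
  qed
  moreover have "hgt a b (Suc j) \<le> rmax (hgt a b) 0 j + 1"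
    using rmax_ge[of 0 j j "hgt a b"] by (simp add: hgt_Suc)
  ultimately show ?case using Suc by (auto simp: pcount_Suc rmax_Suc)
qed simp

lemma pcount_F1: "pcount (a - unm_close a b) = dn (pcount b) (pcount a)"
  by (rule ext) (simp add: pcount_Diff unm_close_subset pcount_unm_close dn_def hgt_def[abs_def])

lemma pcount_F2: "pcount (b \<union> unm_close a b) = up (pcount a) (pcount b)"
  using unm_close_subset(2)[of a b]
  by (intro ext) (simp add: Int_commute pcount_Un pcount_unm_close up_def hgt_def[abs_def])

text \<open>The suffix \<open>l\<close> or \<open>r\<close> tells which of the two neighbouring rows
  is produced; \<open>a\<close> supplies the closing brackets and \<open>b\<close> the opening ones.
  In prefix counts, \<open>Fl\<close> and \<open>Fr\<close> form the Pitman transform of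
  \<open>a\<close>, \<open>b\<close>.\<close>

definition Fl :: "nat set \<Rightarrow> nat set \<Rightarrow> nat set" where "Fl a b = a - unm_close a b"
definition Fr :: "nat set \<Rightarrow> nat set \<Rightarrow> nat set" where "Fr a b = b \<union> unm_close a b"
definition El :: "nat set \<Rightarrow> nat set \<Rightarrow> nat set" where "El a b = a \<union> unm_open a b"
definition Er :: "nat set \<Rightarrow> nat set \<Rightarrow> nat set" where "Er a b = b - unm_open a b"

lemma pcount_Fl: "pcount (Fl a b) = dn (pcount b) (pcount a)"
  and pcount_Fr: "pcount (Fr a b) = up (pcount a) (pcount b)"
  by (simp_all add: Fl_def Fr_def pcount_F1 pcount_F2)

lemma pcount_F_sum: "pcount (Fl a b) j + pcount (Fr a b) j = pcount a j + pcount b j"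
  by (simp add: pcount_Fl pcount_Fr dn_def up_def)

lemma pcount_step: "pcount a (Suc j) - pcount b (Suc j) \<le> pcount a j - pcount b j + 1"
  by (simp add: pcount_Suc)

text \<open>After the move the path is \<open>h - 2 M\<close>, where \<open>M\<close> is at least
  \<open>h\<close> and at least 0. It never rises above zero and sets no records.\<close>

lemma F_idem_close: "unm_close (Fl a b) (Fr a b) = {}"
proof -
  have "pcount (unm_close (Fl a b) (Fr a b)) t = 0" for t
  proof -
    have h: "hgt (Fl a b) (Fr a b) s = hgt a b s - 2 * rmax (hgt a b) 0 s" for s
      by (simp add: hgt_def[of "Fl a b"] pcount_Fl pcount_Fr dn_def up_def hgt_def[abs_def])
    have "hgt (Fl a b) (Fr a b) s \<le> 0" for s
      unfolding h using rmax_ge[of 0 s s "hgt a b"] rmax_ge[of 0 0 s "hgt a b"] by simp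
    then show ?thesis
      using rmax_ge[of 0 0 t "hgt (Fl a b) (Fr a b)"]
      by (intro antisym) (auto simp: pcount_unm_close rmax_le_iff)
  qed
  then have "pcount (unm_close (Fl a b) (Fr a b)) = pcount {}" by (auto simp: pcount_def)
  then show ?thesis by (rule pcount_inject)
qed

text \<open>These are the three components of the braid relation on rows \<open>a\<close>,
  \<open>b\<close>, \<open>c\<close>. The outer ones are \<open>dn_braid\<close> and
  \<open>up_braid\<close> on prefix counts; the middle one follows because the number of balls in
  every prefix is conserved.\<close>

lemma F_braid:
  "Fl (Fl a b) (Fl (Fr a b) c) = Fl a (Fl b c)"
  "Fr (Fl a b) (Fl (Fr a b) c) = Fl (Fr a (Fl b c)) (Fr b c)"
  "Fr (Fr a b) c = Fr (Fr a (Fl b c)) (Fr b c)"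
proof -
  show 1: "Fl (Fl a b) (Fl (Fr a b) c) = Fl a (Fl b c)"
    by (rule pcount_inject) (auto simp: pcount_Fl pcount_Fr dn_braid pcount_step)
  show 3: "Fr (Fr a b) c = Fr (Fr a (Fl b c)) (Fr b c)"
    by (rule pcount_inject) (auto simp: pcount_Fl pcount_Fr up_braid pcount_step)
  show "Fr (Fl a b) (Fl (Fr a b) c) = Fl (Fr a (Fl b c)) (Fr b c)"
  proof (rule pcount_inject, rule ext)
    fix j
    show "pcount (Fr (Fl a b) (Fl (Fr a b) c)) j = pcount (Fl (Fr a (Fl b c)) (Fr b c)) j"
      using pcount_F_sum[of "Fl a b" "Fl (Fr a b) c" j] pcount_F_sum[of "Fr a b" c j] pcount_F_sum[of a b j]
        pcount_F_sum[of "Fr a (Fl b c)" "Fr b c" j] pcount_F_sum[of a "Fl b c" j] pcount_F_sum[of b c j] 1 3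
      by simp
  qed
qed

section \<open>The 0-Hecke relations\<close>

text \<open>Reversing the columns and exchanging the two rows reverses the bracket word and flips
  every bracket, which trades unmatched opening brackets for unmatched closing ones. With
  \<open>N\<close> fixed, this is an involution on subsets of \<open>{..<N}\<close>.\<close>

definition refl_set :: "nat \<Rightarrow> nat set \<Rightarrow> nat set" where
  "refl_set N a = {j. j < N \<and> N - Suc j \<in> a}"

lemma refl_set_subset: "refl_set N a \<subseteq> {..<N}"
  by (auto simp: refl_set_def)

lemma refl_set_refl_set: "a \<subseteq> {..<N} \<Longrightarrow> refl_set N (refl_set N a) = a"
  by (auto simp: refl_set_def)

lemma refl_set_inject: "a \<subseteq> {..<N} \<Longrightarrow> b \<subseteq> {..<N} \<Longrightarrow> refl_set N a = refl_set N b \<Longrightarrow> a = b"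
  by (metis refl_set_refl_set)

lemma pcount_refl_set: "y \<le> N \<Longrightarrow> pcount (refl_set N a) y = pcount a N - pcount a (N - y)"
proof (induction y)
  case (Suc y)
  then have "N - y = Suc (N - Suc y)" by simp
  then have "pcount a (N - y) = pcount a (N - Suc y) + (if N - Suc y \<in> a then 1 else 0)"
    by (metis pcount_Suc)
  then show ?case using Suc by (auto simp: pcount_Suc refl_set_def)
qed simp

lemma hgt_refl_set: "y \<le> N \<Longrightarrow> hgt (refl_set N b) (refl_set N a) y = hgt a b (N - y) - hgt a b N"
  by (simp add: hgt_def pcount_refl_set)

lemma hgt_beyond:
  assumes "a \<subseteq> {..<N}" "b \<subseteq> {..<N}" "N \<le> y"
  shows "hgt a b y = hgt a b N"
proof -
  have "a \<inter> {..<y} = a \<inter> {..<N}" "b \<inter> {..<y} = b \<inter> {..<N}" using assms by auto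
  then show ?thesis by (simp add: hgt_def pcount_def)
qed

lemma mem_unm_open:
  assumes "a \<subseteq> {..<N}" "b \<subseteq> {..<N}" "j < N"
  shows "j \<in> unm_open a b \<longleftrightarrow> (\<forall>y. j < y \<and> y \<le> N \<longrightarrow> hgt a b y < hgt a b j)"
proof
  assume *: "\<forall>y. j < y \<and> y \<le> N \<longrightarrow> hgt a b y < hgt a b j"
  have "hgt a b y < hgt a b j" if "j < y" for y
    using * that assms hgt_beyond[OF assms(1,2), of y] by (cases "y \<le> N") auto
  then show "j \<in> unm_open a b" by (simp add: unm_open_def)
qed (auto simp: unm_open_def)

lemma unm_close_refl_set:
  assumes "a \<subseteq> {..<N}" "b \<subseteq> {..<N}"
  shows "unm_close (refl_set N b) (refl_set N a) = refl_set N (unm_open a b)"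
proof (rule set_eqI)
  fix j
  show "j \<in> unm_close (refl_set N b) (refl_set N a) \<longleftrightarrow> j \<in> refl_set N (unm_open a b)"
  proof (cases "j < N")
    case True
    have "j \<in> unm_close (refl_set N b) (refl_set N a) \<longleftrightarrow> (\<forall>y\<le>j. hgt a b (N - y) < hgt a b (N - Suc j))"
      using True by (auto simp: unm_close_def hgt_refl_set)
    also have "\<dots> \<longleftrightarrow> (\<forall>y. N - Suc j < y \<and> y \<le> N \<longrightarrow> hgt a b y < hgt a b (N - Suc j))"
    proof (intro iffI allI impI)
      fix y assume *: "\<forall>y\<le>j. hgt a b (N - y) < hgt a b (N - Suc j)" and y: "N - Suc j < y \<and> y \<le> N"
      then have "N - y \<le> j" using True by linarith
      with * have "hgt a b (N - (N - y)) < hgt a b (N - Suc j)" by blast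
      then show "hgt a b y < hgt a b (N - Suc j)" using y by simp
    qed (use True in auto)
    also have "\<dots> \<longleftrightarrow> N - Suc j \<in> unm_open a b"
      using mem_unm_open[OF assms, of "N - Suc j"] True by simp
    finally show ?thesis using True by (simp add: refl_set_def)
  next
    case False
    then show ?thesis
      using unm_close_subset(1)[of "refl_set N b" "refl_set N a"] by (auto simp: refl_set_def)
  qed
qed

lemma F_subset: "a \<subseteq> A \<Longrightarrow> b \<subseteq> A \<Longrightarrow> Fl a b \<subseteq> A \<and> Fr a b \<subseteq> A"
  using unm_close_subset[of a b] by (auto simp: Fl_def Fr_def)

lemma E_subset: "a \<subseteq> A \<Longrightarrow> b \<subseteq> A \<Longrightarrow> El a b \<subseteq> A \<and> Er a b \<subseteq> A"
  using unm_open_subset[of a b] by (auto simp: El_def Er_def)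

lemma refl_set_E:
  assumes "a \<subseteq> {..<N}" "b \<subseteq> {..<N}"
  shows "refl_set N (El a b) = Fr (refl_set N b) (refl_set N a)"
    and "refl_set N (Er a b) = Fl (refl_set N b) (refl_set N a)"
  by (auto simp: El_def Er_def Fr_def Fl_def unm_close_refl_set[OF assms])
     (auto simp: refl_set_def)

lemma E_idem_open:
  assumes "a \<subseteq> {..<N}" "b \<subseteq> {..<N}"
  shows "unm_open (El a b) (Er a b) = {}"
proof -
  have E: "El a b \<subseteq> {..<N}" "Er a b \<subseteq> {..<N}" using E_subset assms by auto
  have "refl_set N (unm_open (El a b) (Er a b)) = {}"
    unfolding unm_close_refl_set[OF E, symmetric] refl_set_E[OF assms] by (rule F_idem_close)
  then have "refl_set N (unm_open (El a b) (Er a b)) = refl_set N {}" by (simp add: refl_set_def)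
  moreover have "unm_open (El a b) (Er a b) \<subseteq> {..<N}" using unm_open_subset(1) E by blast
  ultimately show ?thesis using refl_set_inject by blast
qed

text \<open>Reflection also reverses the order of the three rows, so the first equation mirrors the
  third one of \<open>F_braid\<close> and conversely.\<close>

lemma E_braid:
  assumes "a \<subseteq> {..<N}" "b \<subseteq> {..<N}" "c \<subseteq> {..<N}"
  shows "El (El a b) (El (Er a b) c) = El a (El b c)"
    and "Er (El a b) (El (Er a b) c) = El (Er a (El b c)) (Er b c)"
    and "Er (Er a b) c = Er (Er a (El b c)) (Er b c)"
  by (rule refl_set_inject[of _ N];
      simp add: assms E_subset refl_set_E F_braid(1)[of "refl_set N c" "refl_set N b" "refl_set N a"]
        F_braid(2)[of "refl_set N c" "refl_set N b" "refl_set N a"]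
        F_braid(3)[of "refl_set N c" "refl_set N b" "refl_set N a"])+

text \<open>Unmatched opening brackets are the strict records of the path read from the right;
  passing one of them lets the suffix maximum fall by one.\<close>

lemma pcount_unm_open:
  assumes "a \<subseteq> {..<N}" "b \<subseteq> {..<N}" "j \<le> N"
  shows "pcount (unm_open a b) j = rmax (hgt a b) 0 N - rmax (hgt a b) j N"
  using assms(3)
proof (induction j)
  case (Suc j)
  let ?h = "hgt a b"
  have jN: "j < N" using Suc by simp
  have *: "rmax ?h j N = max (?h j) (rmax ?h (Suc j) N)"
  proof -
    have "{j..N} = insert j {Suc j..N}" using jN by auto
    then show ?thesis using jN by (simp add: rmax_def)
  qed
  have "j \<in> unm_open a b \<longleftrightarrow> rmax ?h (Suc j) N < ?h j"
  proof -
    obtain s where s: "Suc j \<le> s" "s \<le> N" "rmax ?h (Suc j) N = ?h s"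
      using rmax_attained Suc.prems by blast
    show ?thesis unfolding mem_unm_open[OF assms(1,2) jN]
    proof (intro iffI allI impI)
      fix y assume "rmax ?h (Suc j) N < ?h j" "j < y \<and> y \<le> N"
      then show "?h y < ?h j" using rmax_ge[of "Suc j" y N ?h] by simp
    qed (use s in auto)
  qed
  moreover have "?h j \<le> rmax ?h (Suc j) N + 1"
    using rmax_ge[of "Suc j" "Suc j" N ?h] jN hgt_Suc[of a b j] by (auto split: if_splits)
  ultimately show ?case using Suc jN by (auto simp: pcount_Suc *)
qed simp

lemma pcount_inject_bounded:
  assumes "a \<subseteq> {..<N}" "b \<subseteq> {..<N}" "\<And>j. j \<le> N \<Longrightarrow> pcount a j = pcount b j"
  shows "a = b"
proof -
  have "j \<in> a \<longleftrightarrow> j \<in> b" if "j < N" for j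
    using assms(3)[of j] assms(3)[of "Suc j"] that by (auto simp: pcount_Suc split: if_splits)
  then show ?thesis using assms by blast
qed

lemma pcount_E:
  "pcount (El a b) j = pcount a j + pcount (unm_open a b) j"
  "pcount (Er a b) j = pcount b j - pcount (unm_open a b) j"
  using unm_open_subset[of a b] by (auto simp: El_def Er_def pcount_Diff pcount_Un Int_commute)

text \<open>By \<open>rmax_pitman\<close> on the interval from \<open>j\<close> to \<open>N\<close>,
  the moved pair has \<open>rmax (hgt a b) 0 j\<close> more unmatched opening brackets before
  \<open>j\<close> than \<open>a\<close>, \<open>b\<close>. This is exactly the number of balls
  lifted there, so the downward move returns them along with its own.\<close>

lemma E_F:
  assumes "a \<subseteq> {..<N}" "b \<subseteq> {..<N}"
  shows "El (Fl a b) (Fr a b) = El a b" and "Er (Fl a b) (Fr a b) = Er a b"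
proof -
  let ?h = "hgt a b"
  have F: "Fl a b \<subseteq> {..<N}" "Fr a b \<subseteq> {..<N}" using F_subset assms by auto
  have h: "hgt (Fl a b) (Fr a b) = (\<lambda>s. ?h s - 2 * rmax ?h 0 s)"
    by (rule ext) (simp add: hgt_def[of "Fl a b"] pcount_Fl pcount_Fr dn_def up_def hgt_def[abs_def])
  have step: "?h (Suc j) \<le> ?h j + 1" for j by (simp add: hgt_Suc)
  have P: "rmax (\<lambda>s. ?h s - 2 * rmax ?h 0 s) j N = rmax ?h j N - rmax ?h 0 j - rmax ?h 0 N" if "j \<le> N" for j
    using rmax_pitman[of ?h j N, OF step that] by linarith
  have U: "pcount (unm_open (Fl a b) (Fr a b)) j = pcount (unm_open a b) j + rmax ?h 0 j" if "j \<le> N" for j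
    unfolding pcount_unm_open[OF F that] pcount_unm_open[OF assms that] h
    using P[OF that] P[of 0] by simp
  have "pcount (Fl a b) j = pcount a j - rmax ?h 0 j" "pcount (Fr a b) j = pcount b j + rmax ?h 0 j" for j
    by (simp_all add: pcount_Fl pcount_Fr dn_def up_def hgt_def[abs_def])
  then have "pcount (El (Fl a b) (Fr a b)) j = pcount (El a b) j"
    "pcount (Er (Fl a b) (Fr a b)) j = pcount (Er a b) j" if "j \<le> N" for j
    using U[OF that] by (simp_all add: pcount_E)
  then show "El (Fl a b) (Fr a b) = El a b" "Er (Fl a b) (Fr a b) = Er a b"
    using pcount_inject_bounded[of _ N] E_subset assms F by meson+
qed

lemma refl_set_F:
  assumes "a \<subseteq> {..<N}" "b \<subseteq> {..<N}"
  shows "refl_set N (Fl a b) = Er (refl_set N b) (refl_set N a)"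
    and "refl_set N (Fr a b) = El (refl_set N b) (refl_set N a)"
  using refl_set_E[of "refl_set N b" N "refl_set N a"] E_subset[of "refl_set N b" "{..<N}" "refl_set N a"]
  by (metis assms refl_set_subset refl_set_refl_set)+

lemma F_E:
  assumes "a \<subseteq> {..<N}" "b \<subseteq> {..<N}"
  shows "Fl (El a b) (Er a b) = Fl a b" and "Fr (El a b) (Er a b) = Fr a b"
  by (rule refl_set_inject[of _ N];
      simp add: assms E_subset F_subset refl_set_E refl_set_F refl_set_subset E_F[of _ N])+

section \<open>The longest word of an abstract 0-Hecke monoid\<close>

primrec chain :: "(nat \<Rightarrow> 's \<Rightarrow> 's) \<Rightarrow> nat \<Rightarrow> 's \<Rightarrow> 's" where
  "chain f 0 x = f 0 x"
| "chain f (Suc m) x = chain f m (f (Suc m) x)"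

text \<open>The word uses \<open>f 0\<close> to \<open>f (m - 1)\<close> and applies
  \<open>chain f 0\<close>, then \<open>chain f 1\<close>, and so on: the staircase reduced word of
  the longest permutation of \<open>m + 1\<close> letters. Both \<open>rhoN\<close> and row-by-row
  column insertion have this form.\<close>

primrec longest :: "(nat \<Rightarrow> 's \<Rightarrow> 's) \<Rightarrow> nat \<Rightarrow> 's \<Rightarrow> 's" where
  "longest f 0 x = x"
| "longest f (Suc m) x = chain f m (longest f m x)"

locale zero_hecke =
  fixes f :: "nat \<Rightarrow> 's \<Rightarrow> 's" and D :: "'s set"
  assumes closed: "x \<in> D \<Longrightarrow> f i x \<in> D"
    and idem: "x \<in> D \<Longrightarrow> f i (f i x) = f i x"
    and comm: "x \<in> D \<Longrightarrow> Suc i < j \<Longrightarrow> f i (f j x) = f j (f i x)"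
    and braid: "x \<in> D \<Longrightarrow> f i (f (Suc i) (f i x)) = f (Suc i) (f i (f (Suc i) x))"
begin

lemma chain_closed: "x \<in> D \<Longrightarrow> chain f m x \<in> D"
  by (induction m arbitrary: x) (auto simp: closed)

lemma longest_closed: "x \<in> D \<Longrightarrow> longest f m x \<in> D"
  by (induction m) (auto simp: chain_closed)

lemma chain_comm: "x \<in> D \<Longrightarrow> Suc m < j \<Longrightarrow> f j (chain f m x) = chain f m (f j x)"
proof (induction m arbitrary: x)
  case 0
  then show ?case using comm[of x 0 j] by simp
next
  case (Suc m)
  then show ?case using comm[of x "Suc m" j] by (simp add: closed)
qed

lemma longest_comm: "x \<in> D \<Longrightarrow> m < j \<Longrightarrow> f j (longest f m x) = longest f m (f j x)"
  by (induction m) (auto simp: chain_comm longest_closed)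

lemma chain_absorb: "x \<in> D \<Longrightarrow> f 0 (chain f m x) = chain f m x"
  by (induction m arbitrary: x) (auto simp: closed idem)

lemma chain_absorb_last: "x \<in> D \<Longrightarrow> chain f m (f m x) = chain f m x"
  by (cases m) (auto simp: closed idem)

text \<open>The leading \<open>f (Suc i)\<close> commutes past the letters before
  \<open>f i\<close>. One braid move there turns it into a trailing \<open>f i\<close>, which
  commutes past the remaining letters.\<close>

lemma chain_shift: "x \<in> D \<Longrightarrow> i < m \<Longrightarrow> f (Suc i) (chain f m x) = chain f m (f i x)"
proof (induction m arbitrary: x)
  case (Suc m)
  show ?case
  proof (cases "i < m")
    case True
    then show ?thesis using Suc comm[of x i "Suc m"] by (simp add: closed)
  next
    case False
    then have i: "i = m" using Suc by simp
    show ?thesis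
    proof (cases m)
      case 0
      then show ?thesis using i Suc.prems braid[of x 0] by simp
    next
      case (Suc k)
      have "f (Suc m) (chain f (Suc m) x) = chain f k (f (Suc m) (f m (f (Suc m) x)))"
        using Suc Suc.prems \<open>x \<in> D\<close> by (simp add: chain_comm closed)
      also have "\<dots> = chain f k (f m (f (Suc m) (f m x)))" using braid \<open>x \<in> D\<close> by simp
      also have "\<dots> = chain f (Suc m) (f i x)" using Suc i by simp
      finally show ?thesis using i by simp
    qed
  qed
qed simp

text \<open>The outermost letter of the last chain absorbs \<open>f 0\<close>; any later generator
  slips through that chain with its index lowered by one and is absorbed by the smaller longest
  word.\<close>

lemma longest_absorb_left: "x \<in> D \<Longrightarrow> i < m \<Longrightarrow> f i (longest f m x) = longest f m x"
proof (induction m arbitrary: i)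
  case (Suc m)
  then show ?case
    by (cases i) (auto simp: chain_absorb longest_closed chain_shift)
qed simp

text \<open>Sliding \<open>chain f k\<close> to the outside of \<open>chain f m\<close> raises its
  indices. Then \<open>chain f m\<close> acts directly on \<open>f m x\<close>, and its innermost
  letter absorbs \<open>f m\<close>.\<close>

lemma chain_shift_chain:
  "x \<in> D \<Longrightarrow> k < m \<Longrightarrow> chain f m (chain f k (f m x)) = chain f m (chain f k x)"
proof -
  have *: "\<exists>w. (\<forall>x\<in>D. w x \<in> D \<and> chain f m (chain f k x) = w (chain f m x))" if "k < m"
    using that
  proof (induction k)
    case 0
    then show ?case using chain_shift closed by (intro exI[of _ "f (Suc 0)"]) simp
  next
    case (Suc k)
    then obtain w where w: "\<forall>x\<in>D. w x \<in> D \<and> chain f m (chain f k x) = w (chain f m x)" by auto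
    show ?case
      using w Suc.prems by (intro exI[of _ "\<lambda>x. w (f (Suc (Suc k)) x)"]) (auto simp: closed chain_shift)
  qed
  assume "x \<in> D" "k < m"
  then show ?thesis using * by (metis chain_absorb_last closed)
qed

lemma longest_absorb_right: "x \<in> D \<Longrightarrow> i < m \<Longrightarrow> longest f m (f i x) = longest f m x"
proof (induction m arbitrary: i)
  case (Suc m)
  show ?case
  proof (cases "i < m")
    case False
    then have i: "i = m" using Suc by simp
    show ?thesis
    proof (cases m)
      case (Suc k)
      then show ?thesis
        using i \<open>x \<in> D\<close> longest_comm[of x k m] chain_shift_chain[of "longest f k x" k m]
        by (simp add: longest_closed)
    qed (use i Suc.prems in \<open>simp add: idem\<close>)
  qed (use Suc in simp)
qed simp

lemma chain_fix: "\<forall>i\<le>m. f i x = x \<Longrightarrow> chain f m x = x"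
  by (induction m) auto

lemma longest_fix: "\<forall>i<m. f i x = x \<Longrightarrow> longest f m x = x"
  by (induction m) (auto simp: chain_fix)

end

text \<open>The longest word in \<open>f\<close> can produce an extra \<open>f i\<close> beside any
  letter \<open>g i\<close>; there \<open>f i (g i x) = f i x\<close> deletes the letter, and the
  extra \<open>f i\<close> is absorbed again.\<close>

lemma (in zero_hecke) longest_longest:
  assumes "zero_hecke g D" and fg: "\<And>i x. x \<in> D \<Longrightarrow> f i (g i x) = f i x" and "x \<in> D"
  shows "longest f m (longest g m x) = longest f m x"
proof -
  interpret g: zero_hecke g D by fact
  have 1: "longest f m (g i y) = longest f m y" if "y \<in> D" "i < m" for i y
    using longest_absorb_right[of "g i y" i m] longest_absorb_right[of y i m] that fg[of y i]
    by (simp add: g.closed)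
  have 2: "longest f m (chain g k y) = longest f m y" if "y \<in> D" "k < m" for k y
    using that by (induction k arbitrary: y) (auto simp: 1 g.closed)
  have "longest f m (longest g k x) = longest f m x" if "k \<le> m" for k
    using that by (induction k) (auto simp: 2 g.longest_closed \<open>x \<in> D\<close>)
  then show ?thesis by simp
qed

section \<open>The two families of operators on states\<close>

definition act :: "(nat set \<Rightarrow> nat set \<Rightarrow> nat set) \<Rightarrow> (nat set \<Rightarrow> nat set \<Rightarrow> nat set) \<Rightarrow> nat \<Rightarrow>
    (nat \<Rightarrow> nat set) \<Rightarrow> (nat \<Rightarrow> nat set)" where
  "act l r i X = X(i := l (X i) (X (Suc i)), Suc i := r (X i) (X (Suc i)))"

abbreviation "opE \<equiv> act El Er"
abbreviation "opF \<equiv> act Fl Fr"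

definition bdd_states :: "nat \<Rightarrow> (nat \<Rightarrow> nat set) set" where
  "bdd_states N = {X. \<forall>i. X i \<subseteq> {..<N}}"

text \<open>The last three assumptions are the braid relation on three consecutive rows, component
  by component; operators that are further apart touch disjoint rows.\<close>

lemma zero_hecke_act:
  assumes "\<And>a b. a \<subseteq> {..<N} \<Longrightarrow> b \<subseteq> {..<N} \<Longrightarrow> l a b \<subseteq> {..<N} \<and> r a b \<subseteq> {..<N}"
    and "\<And>a b. a \<subseteq> {..<N} \<Longrightarrow> b \<subseteq> {..<N} \<Longrightarrow> l (l a b) (r a b) = l a b \<and> r (l a b) (r a b) = r a b"
    and "\<And>a b c. a \<subseteq> {..<N} \<Longrightarrow> b \<subseteq> {..<N} \<Longrightarrow> c \<subseteq> {..<N} \<Longrightarrow> l (l a b) (l (r a b) c) = l a (l b c)"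
    and "\<And>a b c. a \<subseteq> {..<N} \<Longrightarrow> b \<subseteq> {..<N} \<Longrightarrow> c \<subseteq> {..<N} \<Longrightarrow> r (l a b) (l (r a b) c) = l (r a (l b c)) (r b c)"
    and "\<And>a b c. a \<subseteq> {..<N} \<Longrightarrow> b \<subseteq> {..<N} \<Longrightarrow> c \<subseteq> {..<N} \<Longrightarrow> r (r a b) c = r (r a (l b c)) (r b c)"
  shows "zero_hecke (act l r) (bdd_states N)"
proof
  fix X i j assume X: "X \<in> bdd_states N"
  then have b: "X k \<subseteq> {..<N}" for k by (auto simp: bdd_states_def)
  show "act l r i X \<in> bdd_states N"
    using b assms(1)[OF b b] by (auto simp: bdd_states_def act_def)
  show "act l r i (act l r i X) = act l r i X"
    using assms(2)[OF b b] by (auto simp: act_def)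
  show "act l r i (act l r j X) = act l r j (act l r i X)" if "Suc i < j"
    using that by (auto simp: act_def fun_eq_iff)
  show "act l r i (act l r (Suc i) (act l r i X)) = act l r (Suc i) (act l r i (act l r (Suc i) X))"
    using assms(3-5)[OF b b b] by (auto simp: act_def fun_eq_iff)
qed

lemma zero_hecke_E: "zero_hecke opE (bdd_states N)"
proof (rule zero_hecke_act)
  fix a b assume ab: "a \<subseteq> {..<N}" "b \<subseteq> {..<N}"
  show "El (El a b) (Er a b) = El a b \<and> Er (El a b) (Er a b) = Er a b"
    using E_idem_open[OF ab] by (simp add: El_def[of "El a b"] Er_def[of "El a b"])
qed (rule E_braid E_subset; assumption)+

lemma zero_hecke_F: "zero_hecke opF (bdd_states N)"
proof (rule zero_hecke_act)
  fix a b :: "nat set"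
  show "Fl (Fl a b) (Fr a b) = Fl a b \<and> Fr (Fl a b) (Fr a b) = Fr a b"
    using F_idem_close by (simp add: Fl_def[of "Fl a b"] Fr_def[of "Fl a b"])
qed (rule F_braid F_subset; assumption?)+

lemma longest_E_F:
  assumes "X \<in> bdd_states N"
  shows "longest opE m (longest opF m X) = longest opE m X"
proof (rule zero_hecke.longest_longest[OF zero_hecke_E zero_hecke_F _ assms])
  show "opE i (opF i X) = opE i X" if "X \<in> bdd_states N" for i X
    using that E_F[of "X i" N "X (Suc i)"] by (auto simp: act_def bdd_states_def)
qed

lemma longest_F_E:
  assumes "X \<in> bdd_states N"
  shows "longest opF m (longest opE m X) = longest opF m X"
proof (rule zero_hecke.longest_longest[OF zero_hecke_F zero_hecke_E _ assms])
  show "opF i (opE i X) = opF i X" if "X \<in> bdd_states N" for i X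
    using that F_E[of "X i" N "X (Suc i)"] by (auto simp: act_def bdd_states_def)
qed

section \<open>Collapsing\<close>

text \<open>Row \<open>r\<close> of a queue sits at index \<open>r - 1\<close>. Padding with empty
  rows builds in the identification of tuples that differ by empty top rows.\<close>

definition st :: "nat set list \<Rightarrow> nat \<Rightarrow> nat set" where
  "st M i = (if i < length M then M ! i else {})"

lemma st_bdd: "st M \<in> bdd_states N \<longleftrightarrow> (\<forall>B\<in>set M. B \<subseteq> {..<N})"
proof
  assume *: "st M \<in> bdd_states N"
  show "\<forall>B\<in>set M. B \<subseteq> {..<N}"
  proof
    fix B assume "B \<in> set M"
    then obtain i where "i < length M" "B = M ! i" by (auto simp: in_set_conv_nth)
    then show "B \<subseteq> {..<N}" using *[unfolded bdd_states_def, simplified, rule_format, of i] by (simp add: st_def)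
  qed
next
  assume *: "\<forall>B\<in>set M. B \<subseteq> {..<N}"
  then have "st M i \<subseteq> {..<N}" for i using nth_mem[of i M] by (auto simp: st_def)
  then show "st M \<in> bdd_states N" by (simp add: bdd_states_def)
qed

lemma sorted_list_of_set_snoc:
  fixes A :: "nat set"
  assumes "finite A" "\<forall>x\<in>A. x < j"
  shows "sorted_list_of_set (insert j A) = sorted_list_of_set A @ [j]"
proof -
  let ?L = "sorted_list_of_set A @ [j]"
  have "sorted ?L" "distinct ?L" using assms by (auto simp: sorted_append less_imp_le)
  then have "sorted_list_of_set (set ?L) = ?L" by (rule sorted_list_of_set.idem_if_sorted_distinct)
  moreover have "set ?L = insert j A" using assms by simp
  ultimately show ?thesis by metis
qed

lemma par_unmatched_append:
  "par_unmatched i (xs @ ys) s = par_unmatched i ys (par_unmatched i xs s)"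
  by (induction i xs s rule: par_unmatched.induct) auto

lemma par_unmatched_irrelevant:
  "\<forall>p\<in>set xs. fst p \<noteq> i \<and> fst p \<noteq> Suc i \<Longrightarrow> par_unmatched i xs s = s"
  by (induction i xs s rule: par_unmatched.induct) auto

text \<open>Letters other than \<open>i\<close> and \<open>i + 1\<close> are ignored. A column is
  read from top to bottom, so the push for row \<open>i + 1\<close>, which is \<open>M ! i\<close>,
  precedes the pop for row \<open>i\<close>.\<close>

lemma par_unmatched_column:
  assumes "1 \<le> i" "i < length M"
  shows "par_unmatched i (map (\<lambda>r. (r, j)) (filter (\<lambda>r. j \<in> M ! (r - 1)) (rev [1..<Suc (length M)]))) s
    = (let s' = (if j \<in> M ! i then j # s else s) in if j \<in> M ! (i - 1) then drop 1 s' else s')"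
proof -
  have "[1..<Suc (length M)] = [1..<i] @ [i..<Suc (length M)]"
    using upt_add_eq_append[of 1 i "Suc (length M) - i"] assms by simp
  moreover have "[i..<Suc (length M)] = i # Suc i # [Suc (Suc i)..<Suc (length M)]"
    using assms by (simp add: upt_conv_Cons del: upt_Suc)
  ultimately have e: "rev [1..<Suc (length M)] = rev [Suc (Suc i)..<Suc (length M)] @ [Suc i, i] @ rev [1..<i]"
    by (simp del: upt_Suc)
  show ?thesis
    unfolding e by (auto simp: par_unmatched_append par_unmatched_irrelevant Let_def simp del: upt_Suc)
qed

text \<open>The stack of the scan after the columns \<open>< y\<close> consists of the columns that are unmatched so far.\<close>

definition scan_stack :: "nat set \<Rightarrow> nat set \<Rightarrow> nat \<Rightarrow> nat list" where
  "scan_stack a b y = rev (sorted_list_of_set {x. x < y \<and> (\<forall>z. x < z \<and> z \<le> y \<longrightarrow> hgt a b z < hgt a b x)})"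

lemma scan_stack_Suc:
  "scan_stack a b (Suc j) = (let s' = (if j \<in> b then j # scan_stack a b j else scan_stack a b j) in
     if j \<in> a then drop 1 s' else s')"
proof -
  let ?h = "hgt a b"
  define A where "A = (\<lambda>y. {x. x < y \<and> (\<forall>z. x < z \<and> z \<le> y \<longrightarrow> ?h z < ?h x)})"
  have S: "scan_stack a b y = rev (sorted_list_of_set (A y))" for y by (simp add: scan_stack_def A_def)
  have fin: "finite (A y)" for y unfolding A_def by (rule finite_subset[of _ "{..<y}"]) auto
  have A_Suc: "A (Suc j) = {x \<in> A j. ?h (Suc j) < ?h x} \<union> (if ?h (Suc j) < ?h j then {j} else {})"
    by (auto simp: A_def less_Suc_eq le_Suc_eq)
  have hj: "?h j < ?h x" if "x \<in> A j" for x using that by (auto simp: A_def)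
  consider "j \<in> a \<longleftrightarrow> j \<in> b" | "j \<in> b" "j \<notin> a" | "j \<in> a" "j \<notin> b" by blast
  then show ?thesis
  proof cases
    case 1
    then have "?h (Suc j) = ?h j" by (simp add: hgt_Suc)
    then have "A (Suc j) = A j" using A_Suc hj by auto
    then show ?thesis using 1 by (simp add: S)
  next
    case 2
    then have h: "?h (Suc j) = ?h j - 1" by (simp add: hgt_Suc)
    have "A (Suc j) = insert j (A j)" using A_Suc hj by (force simp: h)
    moreover have "\<forall>x\<in>A j. x < j" by (auto simp: A_def)
    ultimately have "sorted_list_of_set (A (Suc j)) = sorted_list_of_set (A j) @ [j]"
      using sorted_list_of_set_snoc[OF fin] by simp
    then show ?thesis using 2 by (simp add: S)
  next
    case 3
    then have h: "?h (Suc j) = ?h j + 1" by (simp add: hgt_Suc)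
    then have A': "A (Suc j) = {x \<in> A j. ?h j + 1 < ?h x}" using A_Suc by simp
    show ?thesis
    proof (cases "A j = {}")
      case True
      then show ?thesis using 3 A' by (simp add: S)
    next
      case False
      then obtain x0 where x0: "x0 \<in> A j" by blast
      then have x0j: "x0 < j" "?h j < ?h x0" by (auto simp: A_def)
      \<comment> \<open>The bracket to be popped is the last column whose height exceeds the current
        one. The path falls by at most one per column, so that height is larger by exactly one, and
        every other entry of the stack is higher still.\<close>
      define x where "x = (GREATEST x. x \<le> j \<and> ?h j < ?h x)"
      have x: "x \<le> j" "?h j < ?h x"
        using GreatestI_nat[of "\<lambda>x. x \<le> j \<and> ?h j < ?h x" x0 j] x0j by (auto simp: x_def)
      have le: "y \<le> x" if "y \<le> j" "?h j < ?h y" for y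
        unfolding x_def using Greatest_le_nat[of "\<lambda>x. x \<le> j \<and> ?h j < ?h x" y j] that by auto
      have xj: "x < j" using x by (cases "x = j") auto
      have "?h (Suc x) \<le> ?h j" using le[of "Suc x"] xj by fastforce
      moreover have "?h x \<le> ?h (Suc x) + 1" by (simp add: hgt_Suc)
      ultimately have hx: "?h x = ?h j + 1" using x by linarith
      have xA: "x \<in> A j"
        using xj hx le by (fastforce simp: A_def)
      have mx: "y < x" "?h j + 1 < ?h y" if "y \<in> A j" "y \<noteq> x" for y
      proof -
        show "y < x" using le[of y] hj[of y] that by (auto simp: A_def)
        then have "?h x < ?h y" using that(1) x by (auto simp: A_def)
        then show "?h j + 1 < ?h y" using hx by simp
      qed
      have "A j = insert x (A (Suc j))" using A' xA mx(2) hx by auto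
      moreover have "\<forall>y\<in>A (Suc j). y < x"
      proof
        fix y assume "y \<in> A (Suc j)"
        then have "y \<in> A j" "y \<noteq> x" using A' hx by auto
        then show "y < x" by (rule mx(1))
      qed
      ultimately have "sorted_list_of_set (A j) = sorted_list_of_set (A (Suc j)) @ [x]"
        using sorted_list_of_set_snoc fin by metis
      then show ?thesis using 3 by (simp add: S)
    qed
  qed
qed

text \<open>\<open>cw_pos\<close> visits only columns that contain a ball; adding the empty ones
  lets the scan be followed by induction over all columns.\<close>

lemma concat_map_sorted_list_of_set:
  fixes A :: "nat set"
  assumes "A \<subseteq> {..<N}" "\<And>j. j \<notin> A \<Longrightarrow> g j = []"
  shows "concat (map g (sorted_list_of_set A)) = concat (map g [0..<N])"
proof -
  have "finite A" using assms(1) finite_subset by blast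
  then have "sorted_list_of_set A = filter (\<lambda>j. j \<in> A) [0..<N]"
    using assms(1) by (intro sorted_distinct_set_unique) (auto simp: sorted_wrt_filter)
  moreover have "concat (map g (filter (\<lambda>j. j \<in> A) xs)) = concat (map g xs)" for xs
    by (induction xs) (auto simp: assms(2))
  ultimately show ?thesis by simp
qed

lemma set_par_unmatched:
  assumes "1 \<le> i" "i < length M" "st M \<in> bdd_states N"
  shows "set (par_unmatched i (cw_pos M) []) = unm_open (M ! (i - 1)) (M ! i)"
proof -
  let ?a = "M ! (i - 1)" and ?b = "M ! i"
  let ?h = "hgt ?a ?b"
  define g where "g j = map (\<lambda>r. (r, j)) (filter (\<lambda>r. j \<in> M ! (r - 1)) (rev [1..<Suc (length M)]))" for j
  have "\<Union> (set M) \<subseteq> {..<N}" using assms(3) by (auto simp: st_bdd)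
  moreover have "g j = []" if "j \<notin> \<Union> (set M)" for j
  proof -
    have "j \<notin> M ! (r - 1)" if "r \<in> {1..length M}" for r
      using that \<open>j \<notin> \<Union> (set M)\<close> nth_mem[of "r - 1" M] by auto
    then show ?thesis by (auto simp: g_def filter_empty_conv)
  qed
  ultimately have cw: "cw_pos M = concat (map g [0..<N])"
    unfolding cw_pos_def g_def[symmetric] by (rule concat_map_sorted_list_of_set)
  have "par_unmatched i (concat (map g [0..<y])) [] = scan_stack ?a ?b y" for y
  proof (induction y)
    case 0
    then show ?case by (simp add: scan_stack_def)
  next
    case (Suc y)
    have "par_unmatched i (concat (map g [0..<Suc y])) [] = par_unmatched i (g y) (scan_stack ?a ?b y)"
      using Suc by (simp add: par_unmatched_append)
    also have "\<dots> = scan_stack ?a ?b (Suc y)"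
      unfolding g_def par_unmatched_column[OF assms(1,2)] scan_stack_Suc ..
    finally show ?case .
  qed
  then have "set (par_unmatched i (cw_pos M) []) = {x. x < N \<and> (\<forall>z. x < z \<and> z \<le> N \<longrightarrow> ?h z < ?h x)}"
    by (simp add: cw scan_stack_def)
  also have "\<dots> = unm_open ?a ?b"
  proof -
    have ab: "?a \<subseteq> {..<N}" "?b \<subseteq> {..<N}" using assms by (auto simp: st_bdd)
    then show ?thesis
      using mem_unm_open[OF ab] unm_open_subset(1)[of ?a ?b] by blast
  qed
  finally show ?thesis .
qed

lemma length_estar [simp]: "length (estar i M) = length M"
  by (simp add: estar_def Let_def)

lemma st_estar:
  assumes "Suc i < length M" "st M \<in> bdd_states N"
  shows "st (estar (Suc i) M) = opE i (st M)"
proof (rule ext)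
  fix k
  show "st (estar (Suc i) M) k = opE i (st M) k"
    using set_par_unmatched[of "Suc i" M N] assms
    by (auto simp: estar_def Let_def st_def act_def El_def Er_def nth_list_update)
qed

lemma st_estar_chain:
  assumes "Suc m < length M" "st M \<in> bdd_states N"
  shows "st (foldr estar [1..<Suc (Suc m)] M) = chain opE m (st M) \<and>
    length (foldr estar [1..<Suc (Suc m)] M) = length M"
  using assms
proof (induction m arbitrary: M)
  case 0
  then show ?case by (simp add: st_estar)
next
  case (Suc m)
  have "st (estar (Suc (Suc m)) M) \<in> bdd_states N"
    using Suc.prems st_estar[of "Suc m" M N] zero_hecke.closed[OF zero_hecke_E] by simp
  then show ?case
    using Suc.IH[of "estar (Suc (Suc m)) M"] Suc.prems st_estar[of "Suc m" M N] by simp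
qed

lemma st_rhoN:
  assumes "st B \<in> bdd_states N"
  shows "st (rhoN B) = longest opE (length B - 1) (st B)"
proof -
  have "st (foldl (\<lambda>M m. estar_int 1 m M) B [1..<Suc m]) = longest opE m (st B) \<and>
      length (foldl (\<lambda>M m. estar_int 1 m M) B [1..<Suc m]) = length B" if "m < length B" for m
    using that
  proof (induction m)
    case (Suc m)
    let ?M = "foldl (\<lambda>M m. estar_int 1 m M) B [1..<Suc m]"
    have M: "st ?M = longest opE m (st B)" "length ?M = length B" using Suc by auto
    moreover have "st ?M \<in> bdd_states N"
      unfolding M(1) using zero_hecke.longest_closed[OF zero_hecke_E assms] .
    ultimately show ?case
      using st_estar_chain[of m ?M N] Suc.prems by (simp add: estar_int_def del: upt_Suc add: upt_Suc_append)
  qed simp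
  from this[of "length B - 1"] show ?thesis
    by (cases B) (auto simp: rhoN_def)
qed

section \<open>Replacing one-ball rows by full rows\<close>

lemma unm_open_less:
  assumes "\<And>x y. x \<in> a \<Longrightarrow> y \<in> b \<Longrightarrow> x < y"
  shows "unm_open a b = b"
proof (rule antisym[OF unm_open_subset(1)], rule subsetI)
  fix j assume j: "j \<in> b"
  have "hgt a b y < hgt a b j" if "j < y" for y
  proof -
    have "a \<inter> {..<y} = a \<inter> {..<j}" using assms j that by fastforce
    then have "pcount a y = pcount a j" by (simp add: pcount_def)
    moreover have "pcount b (Suc j) \<le> pcount b y" using that by (simp add: pcount_mono)
    ultimately show ?thesis using j by (simp add: hgt_def pcount_Suc)
  qed
  then show "j \<in> unm_open a b" by (simp add: unm_open_def)
qed

text \<open>No closing bracket of \<open>a\<close> follows an opening one of \<open>b\<close>, so a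
  single \<open>opE\<close> moves all of \<open>b\<close> down; the longest word absorbs this
  operator on its right.\<close>

lemma longest_merge:
  assumes "st (P @ a # b # R) \<in> bdd_states N" "length P < m" "\<And>x y. x \<in> a \<Longrightarrow> y \<in> b \<Longrightarrow> x < y"
  shows "longest opE m (st (P @ a # b # R)) = longest opE m (st (P @ (a \<union> b) # {} # R))"
proof -
  have "opE (length P) (st (P @ a # b # R)) = st (P @ (a \<union> b) # {} # R)"
    by (rule ext) (auto simp: act_def st_def El_def Er_def unm_open_less[OF assms(3)] nth_append nth_Cons')
  then show ?thesis
    using zero_hecke.longest_absorb_right[OF zero_hecke_E assms(1,2)] by simp
qed

text \<open>Merging an empty row with the row above it moves the gap up by one, until it reaches the
  top and becomes part of the padding.\<close>

lemma longest_drop_empty: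
  assumes "st (P @ {} # R) \<in> bdd_states N" "length P + length R \<le> m"
  shows "longest opE m (st (P @ {} # R)) = longest opE m (st (P @ R))"
  using assms
proof (induction R arbitrary: P)
  case Nil
  have "st (P @ [{}]) = st P" by (rule ext) (auto simp: st_def nth_append)
  then show ?case by simp
next
  case (Cons b R)
  have "longest opE m (st (P @ {} # b # R)) = longest opE m (st ((P @ [b]) @ {} # R))"
    using longest_merge[of P "{}" b R N m] Cons.prems by simp
  also have "\<dots> = longest opE m (st ((P @ [b]) @ R))"
    using Cons.prems by (intro Cons.IH) (auto simp: st_bdd)
  finally show ?case by simp
qed

lemma longest_merge_singletons:
  assumes "st (P @ c # map (\<lambda>x. {x}) xs @ R) \<in> bdd_states N" "length P + length xs + length R \<le> m"
    "sorted_wrt (<) xs" "\<And>x y. x \<in> c \<Longrightarrow> y \<in> set xs \<Longrightarrow> x < y"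
  shows "longest opE m (st (P @ c # map (\<lambda>x. {x}) xs @ R)) = longest opE m (st (P @ (c \<union> set xs) # R))"
  using assms
proof (induction xs arbitrary: c)
  case (Cons x xs)
  have "longest opE m (st (P @ c # {x} # map (\<lambda>x. {x}) xs @ R))
      = longest opE m (st ((P @ [c \<union> {x}]) @ {} # map (\<lambda>x. {x}) xs @ R))"
    using longest_merge[of P c "{x}" "map (\<lambda>x. {x}) xs @ R" N m] Cons.prems by simp
  also have "\<dots> = longest opE m (st ((P @ [c \<union> {x}]) @ map (\<lambda>x. {x}) xs @ R))"
    using Cons.prems by (intro longest_drop_empty[of _ _ N]) (auto simp: st_bdd)
  also have "\<dots> = longest opE m (st (P @ (c \<union> {x} \<union> set xs) # R))"
    using Cons.IH[of "c \<union> {x}"] Cons.prems by (auto simp: st_bdd)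
  finally show ?case by simp
qed simp

lemma set_rw: "\<forall>b\<in>set B. finite b \<Longrightarrow> set (rw B) = \<Union> (set B)"
  by (auto simp: rw_def)

text \<open>Each row is spelled by an increasing run, whose one-ball rows merge into it. The bound
  on \<open>m\<close> provides a generator at every position where a merge takes place.\<close>

lemma longest_rw:
  assumes "st (P @ B) \<in> bdd_states N" "\<forall>b\<in>set B. b \<noteq> {}" "length P + length (rw B) \<le> Suc m"
  shows "longest opE m (st (P @ map (\<lambda>x. {x}) (rw B))) = longest opE m (st (P @ B))"
  using assms
proof (induction B arbitrary: P)
  case (Cons b B)
  have fin: "finite b" using Cons.prems(1) finite_subset[of b "{..<N}"] by (auto simp: st_bdd)
  obtain x xs where b: "sorted_list_of_set b = x # xs"
    using Cons.prems(2) fin by (cases "sorted_list_of_set b") auto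
  have sb: "set (x # xs) = b" and so: "sorted_wrt (<) (x # xs)"
    using fin strict_sorted_list_of_set[of b] by (auto simp: b[symmetric])
  have rwB: "rw (b # B) = x # xs @ rw B" by (simp add: rw_def b)
  have fB: "finite c" if "c \<in> set B" for c
    using that Cons.prems(1) finite_subset[of c "{..<N}"] by (auto simp: st_bdd)
  have "st (P @ {x} # map (\<lambda>x. {x}) xs @ map (\<lambda>x. {x}) (rw B)) \<in> bdd_states N"
    using Cons.prems(1) sb set_rw[of B] fB by (auto simp: st_bdd)
  then have "longest opE m (st (P @ {x} # map (\<lambda>x. {x}) xs @ map (\<lambda>x. {x}) (rw B)))
      = longest opE m (st (P @ ({x} \<union> set xs) # map (\<lambda>x. {x}) (rw B)))"
    using Cons.prems(3) so rwB by (intro longest_merge_singletons) auto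
  also have "\<dots> = longest opE m (st ((P @ [b]) @ map (\<lambda>x. {x}) (rw B)))" using sb by simp
  also have "\<dots> = longest opE m (st ((P @ [b]) @ B))"
    using Cons.prems rwB by (intro Cons.IH) auto
  finally show ?case using rwB by simp
qed (simp add: rw_def)

lemma chain_act_beyond: "Suc m < k \<Longrightarrow> chain (act l r) m X k = X k"
  by (induction m arbitrary: X) (auto simp: act_def)

lemma longest_act_beyond: "m < k \<Longrightarrow> longest (act l r) m X k = X k"
  by (induction m) (auto simp: chain_act_beyond)

lemma unm_open_empty: "unm_open a {} = {}"
  using unm_open_subset(1) by blast

lemma opE_fix: "opE i X = X \<longleftrightarrow> unm_open (X i) (X (Suc i)) = {}"
proof
  assume "opE i X = X"
  from fun_cong[OF this, of i] have "El (X i) (X (Suc i)) = X i" by (simp add: act_def)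
  then show "unm_open (X i) (X (Suc i)) = {}"
    using unm_open_subset(2)[of "X i" "X (Suc i)"] by (auto simp: El_def)
qed (auto simp: act_def El_def Er_def)

text \<open>\<open>rho\<close> works with as many rows as the word has letters. Beyond
  \<open>m\<close> the rows are empty, so the state is fixed by \<open>opE k\<close> as well as by
  all lower generators, and each further chain is trivial.\<close>

lemma longest_stable:
  assumes "st B \<in> bdd_states N" "length B \<le> Suc m" "m \<le> k"
  shows "longest opE k (st B) = longest opE m (st B)"
  using assms(3)
proof (induction k rule: dec_induct)
  case (step k)
  let ?Y = "longest opE k (st B)"
  have "?Y (Suc k) = {}" using assms(2) step by (simp add: longest_act_beyond st_def)
  then have "opE k ?Y = ?Y" by (simp add: opE_fix unm_open_empty)
  moreover have "opE i ?Y = ?Y" if "i < k" for i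
    using zero_hecke.longest_absorb_left[OF zero_hecke_E assms(1) that] .
  ultimately have "chain opE k ?Y = ?Y"
    using zero_hecke.chain_fix[OF zero_hecke_E] by (metis le_neq_implies_less)
  then show ?case using step by simp
qed simp

lemma length_rw_ge:
  assumes "\<forall>b\<in>set B. b \<noteq> {} \<and> finite b"
  shows "length B \<le> length (rw B)"
  using assms
proof (induction B)
  case (Cons b B)
  then have "1 \<le> card b" by (simp add: Suc_le_eq card_gt_0_iff)
  with Cons show ?case by (auto simp: rw_def)
qed simp

lemma st_rho_rw:
  assumes "st B \<in> bdd_states N" "\<forall>b\<in>set B. b \<noteq> {}"
  shows "st (rho (rw B)) = longest opE (length B - 1) (st B)"
proof -
  have fin: "\<forall>b\<in>set B. b \<noteq> {} \<and> finite b"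
    using assms by (auto simp: st_bdd intro: finite_subset)
  have "st (map (\<lambda>x. {x}) (rw B)) \<in> bdd_states N"
    using assms fin set_rw[of B] by (auto simp: st_bdd)
  then have "st (rho (rw B)) = longest opE (length (rw B) - 1) (st (map (\<lambda>x. {x}) (rw B)))"
    unfolding rho_def by (simp add: st_rhoN)
  also have "\<dots> = longest opE (length (rw B) - 1) (st B)"
    using longest_rw[of "[]" B N] assms by simp
  also have "\<dots> = longest opE (length B - 1) (st B)"
    using length_rw_ge[OF fin] assms by (intro longest_stable) auto
  finally show ?thesis .
qed

lemma strip_top_eq:
  assumes "st R = st M" "\<forall>b\<in>set M. b \<noteq> {}"
  shows "strip_top R = M"
proof -
  have len: "length M \<le> length R"
  proof (rule ccontr)
    assume *: "\<not> length M \<le> length R"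
    then have "M ! length R \<noteq> {}" using assms(2) by simp
    then show False using fun_cong[OF assms(1), of "length R"] * by (simp add: st_def)
  qed
  have R: "R = M @ replicate (length R - length M) {}"
  proof (rule nth_equalityI)
    fix i assume "i < length R"
    then show "R ! i = (M @ replicate (length R - length M) {}) ! i"
      using fun_cong[OF assms(1), of i] by (auto simp: st_def nth_append)
  qed (use len in simp)
  have "strip_top (M @ replicate k {}) = M" for k
  proof -
    have "dropWhile (\<lambda>B. B = {}) (replicate k {} @ rev M) = dropWhile (\<lambda>B. B = {}) (rev M)"
      by (induction k) auto
    moreover have "dropWhile (\<lambda>B. B = {}) (rev M) = rev M"
      using assms(2) hd_in_set[of "rev M"] by (auto simp: dropWhile_eq_self_iff)
    ultimately show ?thesis by (simp add: strip_top_def)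
  qed
  then show ?thesis by (subst R)
qed

section \<open>Column insertion\<close>

lemma hgt_insert:
  assumes "x \<notin> b"
  shows "hgt a (insert x b) y = hgt a b y - (if x < y then 1 else 0)"
  by (induction y) (use assms in \<open>auto simp: hgt_Suc less_Suc_eq\<close>)

text \<open>The added opening bracket lowers the path by one beyond \<open>x\<close> and so costs
  exactly the first record set from \<open>x\<close> on. In insertion this is the entry bumped by
  \<open>x\<close>.\<close>

lemma unm_close_insert:
  assumes "\<forall>y\<in>b. y < x"
  shows "unm_close a (insert x b) = {j \<in> unm_close a b. j < x \<or> (\<exists>t\<in>unm_close a b. x \<le> t \<and> t < j)}"
proof (rule set_eqI)
  fix j
  let ?h = "hgt a b" and ?V = "unm_close a b"
  have h: "hgt a (insert x b) y = ?h y - (if x < y then 1 else 0)" for y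
    using assms by (intro hgt_insert) auto
  show "j \<in> unm_close a (insert x b) \<longleftrightarrow> j \<in> {j \<in> ?V. j < x \<or> (\<exists>t\<in>?V. x \<le> t \<and> t < j)}"
  proof (cases "j < x")
    case True
    then show ?thesis by (auto simp: unm_close_def h)
  next
    case False
    then have jx: "x \<le> j" by simp
    show ?thesis
    proof
      assume "j \<in> unm_close a (insert x b)"
      then have *: "?h y - (if x < y then 1 else 0) < ?h (Suc j) - 1" if "y \<le> j" for y
        using that jx by (auto simp: unm_close_def h)
      have jV: "j \<in> ?V" unfolding unm_close_def
      proof (intro CollectI allI impI)
        fix y assume "y \<le> j"
        from *[OF this] show "?h y < ?h (Suc j)" by (auto split: if_splits)
      qed
      let ?m = "rmax ?h 0 x"
      obtain z where "z \<le> x" "?m = ?h z" using rmax_attained[of 0 x ?h] by auto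
      then have "?m < ?h (Suc j) - 1" using *[of z] jx by simp
      moreover have "?h (Suc j) \<le> ?h j + 1" by (simp add: hgt_Suc)
      ultimately have mj: "?m + 1 \<le> ?h j" by linarith
      have hx: "?h x \<le> ?m" by (simp add: rmax_ge)
      have step: "?h (Suc i) \<le> ?h i + 1" for i by (simp add: hgt_Suc)
      \<comment> \<open>Column \<open>j\<close> clears the maximum up to \<open>x\<close> by at
        least two, so level \<open>?m + 1\<close> is passed before it; the column \<open>t\<close>
        of that passage is a record with \<open>x \<le> t < j\<close>.\<close>
      obtain s where s: "x \<le> s" "s \<le> j" "?h s = ?m + 1" "\<forall>y. x \<le> y \<and> y < s \<longrightarrow> ?h y < ?m + 1"
        using first_visit[of ?h, OF step jx, of "?m + 1"] hx mj by auto
      have "s \<noteq> x" using s(3) hx by auto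
      then obtain t where t: "s = Suc t" "x \<le> t" using s(1) by (cases s) auto
      have "t \<in> ?V" unfolding unm_close_def
      proof (intro CollectI allI impI)
        fix y assume "y \<le> t"
        show "?h y < ?h (Suc t)"
        proof (cases "x \<le> y")
          case True
          then show ?thesis using s(3) s(4)[rule_format, of y] t \<open>y \<le> t\<close> by simp
        next
          case False
          then have "?h y \<le> ?m" by (simp add: rmax_ge)
          then show ?thesis using s(3) t by simp
        qed
      qed
      then show "j \<in> {j \<in> ?V. j < x \<or> (\<exists>t\<in>?V. x \<le> t \<and> t < j)}"
        using jV t s(2) by auto
    next
      assume "j \<in> {j \<in> ?V. j < x \<or> (\<exists>t\<in>?V. x \<le> t \<and> t < j)}"
      then obtain t where j: "j \<in> ?V" and t: "t \<in> ?V" "x \<le> t" "t < j" using False by auto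
      show "j \<in> unm_close a (insert x b)" unfolding unm_close_def
      proof (intro CollectI allI impI)
        fix y assume y: "y \<le> j"
        have "?h y < ?h (Suc j)" using j y by (simp add: unm_close_def)
        moreover have "?h y < ?h (Suc t)" "?h (Suc t) < ?h (Suc j)" if "y \<le> x"
          using j t that by (auto simp: unm_close_def)
        ultimately show "hgt a (insert x b) y < hgt a (insert x b) (Suc j)"
          using jx unfolding h by (cases "x < y") force+
      qed
    qed
  qed
qed

text \<open>Beyond \<open>t\<close> there are no opening brackets, so the path never falls again and
  every later closing bracket sets a record. Consequently the bumped entries leave a column in
  increasing order.\<close>

lemma unm_close_after:
  assumes "\<forall>y\<in>b. y < x" "t \<in> unm_close a b" "x \<le> t" "z \<in> a" "t < z"
  shows "z \<in> unm_close a b"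
  unfolding unm_close_def
proof (intro CollectI allI impI)
  fix y assume y: "y \<le> z"
  let ?h = "hgt a b"
  have mono: "?h i \<le> ?h k" if "t < i" "i \<le> k" for i k
  proof -
    have "b \<inter> {..<i} = b \<inter> {..<k}" using assms(1,3) that by fastforce
    then have "pcount b i = pcount b k" by (simp add: pcount_def)
    then show ?thesis using pcount_mono[OF that(2)] by (simp add: hgt_def)
  qed
  have "z \<notin> b" using assms by auto
  then have z: "?h (Suc z) = ?h z + 1" using assms by (simp add: hgt_Suc)
  show "?h y < ?h (Suc z)"
  proof (cases "t < y")
    case True
    then show ?thesis using mono[of y z] y z by simp
  next
    case False
    then have "?h y < ?h (Suc t)" using assms(2) by (simp add: unm_close_def)
    then show ?thesis using mono[of "Suc t" z] assms(5) z by simp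
  qed
qed

lemma unm_close_empty [simp]: "unm_close a {} = a" "unm_close {} b = {}"
proof -
  have "j \<in> unm_close a {}" if "j \<in> a" for j unfolding unm_close_def
  proof (intro CollectI allI impI)
    fix y assume "y \<le> j"
    then have "pcount a y \<le> pcount a j" by (rule pcount_mono)
    moreover have "pcount {} k = 0" for k by (simp add: pcount_def)
    ultimately show "hgt a {} y < hgt a {} (Suc j)" using that by (simp add: hgt_def pcount_Suc)
  qed
  then show "unm_close a {} = a" using unm_close_subset(1)[of a "{}"] by auto
  show "unm_close {} b = {}" using unm_close_subset(1)[of "{}" b] by auto
qed

lemma sorted_list_of_set_split:
  fixes t :: nat
  assumes "finite A" "finite B" "\<forall>x\<in>A. x < t" "\<forall>x\<in>B. t < x"
  shows "sorted_list_of_set (insert t (A \<union> B)) = sorted_list_of_set A @ t # sorted_list_of_set B"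
proof -
  let ?L = "sorted_list_of_set A @ t # sorted_list_of_set B"
  have "sorted ?L" "distinct ?L" using assms by (fastforce simp: sorted_append less_imp_le)+
  then have "sorted_list_of_set (set ?L) = ?L" by (rule sorted_list_of_set.idem_if_sorted_distinct)
  moreover have "set ?L = insert t (A \<union> B)" using assms by auto
  ultimately show ?thesis by metis
qed

lemma col_insert_append:
  assumes "finite C" "\<forall>y\<in>C. y < x"
  shows "col_insert x (sorted_list_of_set C # cs) = sorted_list_of_set (insert x C) # cs"
proof -
  have *: "takeWhile (\<lambda>y. y < x) (sorted_list_of_set C) = sorted_list_of_set C"
    using assms by (simp add: takeWhile_eq_all_conv)
  show ?thesis unfolding col_insert.simps Let_def * by (simp add: sorted_list_of_set_snoc[OF assms])
qed

lemma col_insert_bump: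
  assumes "finite C" "t \<in> C" "x \<le> t" "\<forall>y\<in>C. y < x \<or> t \<le> y"
  shows "col_insert x (sorted_list_of_set C # cs) = sorted_list_of_set (insert x (C - {t})) # col_insert t cs"
proof -
  define A where "A = {y \<in> C. y < x}"
  define B where "B = {y \<in> C. t < y}"
  have fin: "finite A" "finite B" using assms(1) by (auto simp: A_def B_def)
  have C: "C = insert t (A \<union> B)" "insert x (C - {t}) = insert x (A \<union> B)"
    using assms by (auto simp: A_def B_def)
  have "sorted_list_of_set C = sorted_list_of_set A @ t # sorted_list_of_set B"
    unfolding C(1) using fin assms(3) by (intro sorted_list_of_set_split) (auto simp: A_def B_def)
  moreover have "sorted_list_of_set (insert x (C - {t})) = sorted_list_of_set A @ x # sorted_list_of_set B"
    unfolding C(2) using fin assms(3) by (intro sorted_list_of_set_split) (auto simp: A_def B_def)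
  moreover have "takeWhile (\<lambda>y. y < x) (sorted_list_of_set A @ t # sorted_list_of_set B) = sorted_list_of_set A"
    using fin assms(3) by (subst takeWhile_append2) (auto simp: A_def)
  ultimately show ?thesis by (simp add: Let_def nth_append list_update_append)
qed

abbreviation "col_inserts \<equiv> foldl (\<lambda>T x. col_insert x T)"

text \<open>Inserting an increasing word into one column is bracket matching: an entry of
  \<open>a\<close> is bumped exactly if it is matched by a letter, and the unmatched entries stay
  together with the letters. The bumped entries come out increasing, so the next column again
  receives an increasing word.\<close>

lemma col_inserts_Cons:
  assumes "finite a" "sorted_wrt (<) xs"
  shows "col_inserts (sorted_list_of_set a # cs) xs
    = sorted_list_of_set (Fr a (set xs)) # col_inserts cs (sorted_list_of_set (Fl a (set xs)))"
  using assms(2)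
proof (induction xs rule: rev_induct)
  case Nil
  then show ?case by (simp add: Fr_def Fl_def)
next
  case (snoc x xs)
  let ?b = "set xs" and ?V = "unm_close a (set xs)"
  have lt: "\<forall>y\<in>?b. y < x" using snoc.prems by (simp add: sorted_wrt_append)
  have fV: "finite ?V" using unm_close_subset(1) assms(1) finite_subset by blast
  have IH: "col_inserts (sorted_list_of_set a # cs) (xs @ [x])
     = col_insert x (sorted_list_of_set (Fr a ?b) # col_inserts cs (sorted_list_of_set (Fl a ?b)))"
    using snoc by (simp add: sorted_wrt_append)
  have fC: "finite (Fr a ?b)" using fV by (simp add: Fr_def)
  show ?case
  proof (cases "\<exists>t\<in>?V. x \<le> t")
    case False
    then have V': "unm_close a (insert x ?b) = ?V"
      unfolding unm_close_insert[OF lt] by fastforce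
    have "\<forall>y\<in>Fr a ?b. y < x" using False lt by (auto simp: Fr_def)
    then show ?thesis unfolding IH by (subst col_insert_append[OF fC]) (auto simp: V' Fr_def Fl_def)
  next
    case True
    \<comment> \<open>This is the entry bumped by \<open>x\<close>: the letters in \<open>?b\<close>
      lie below \<open>x\<close>, so the least entry of the current column that is at least
      \<open>x\<close> is an unmatched one of \<open>a\<close>.\<close>
    define t where "t = Min {t \<in> ?V. x \<le> t}"
    have "t \<in> {t \<in> ?V. x \<le> t}" unfolding t_def using True fV by (intro Min_in) auto
    then have t: "t \<in> ?V" "x \<le> t" by auto
    have tmin: "t \<le> y" if "y \<in> ?V" "x \<le> y" for y unfolding t_def using that fV by (intro Min_le) auto
    have V': "unm_close a (insert x ?b) = ?V - {t}"
    proof -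
      have "(y < x \<or> (\<exists>s\<in>?V. x \<le> s \<and> s < y)) \<longleftrightarrow> y \<noteq> t" if "y \<in> ?V" for y
        using t tmin that by (metis le_neq_implies_less not_less)
      then show ?thesis unfolding unm_close_insert[OF lt] by auto
    qed
    have tb: "t \<notin> ?b" "t \<in> a" using t unm_close_subset[of a ?b] by auto
    have "\<forall>y\<in>Fr a ?b. y < x \<or> t \<le> y" unfolding Fr_def using lt tmin leI by blast
    then have "col_inserts (sorted_list_of_set a # cs) (xs @ [x])
      = sorted_list_of_set (insert x (Fr a ?b - {t})) # col_insert t (col_inserts cs (sorted_list_of_set (Fl a ?b)))"
      unfolding IH using t by (intro col_insert_bump[OF fC]) (auto simp: Fr_def)
    also have "insert x (Fr a ?b - {t}) = Fr a (set (xs @ [x]))"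
      using tb by (auto simp: Fr_def V')
    also have "col_insert t (col_inserts cs (sorted_list_of_set (Fl a ?b)))
      = col_inserts cs (sorted_list_of_set (Fl a ?b) @ [t])" by simp
    also have "sorted_list_of_set (Fl a ?b) @ [t] = sorted_list_of_set (insert t (Fl a ?b))"
    proof (rule sorted_list_of_set_snoc[symmetric])
      show "finite (Fl a ?b)" using assms(1) by (simp add: Fl_def)
      show "\<forall>z\<in>Fl a ?b. z < t"
      proof
        fix z assume "z \<in> Fl a ?b"
        then have "z \<in> a" "z \<notin> ?V" by (auto simp: Fl_def)
        then show "z < t" using unm_close_after[OF lt t] t(1) by (metis linorder_neqE_nat)
      qed
    qed
    also have "insert t (Fl a ?b) = Fl a (set (xs @ [x]))"
      using tb t by (auto simp: Fl_def V')
    finally show ?thesis .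
  qed
qed

lemma col_inserts_Nil:
  assumes "sorted_wrt (<) xs"
  shows "col_inserts [] xs = (if xs = [] then [] else [xs])"
proof (cases xs)
  case (Cons x ys)
  have "col_inserts [] xs = col_inserts [sorted_list_of_set {}] xs" using Cons by simp
  also have "\<dots> = [sorted_list_of_set (set xs)]"
    using col_inserts_Cons[of "{}" xs "[]"] assms by (simp add: Fr_def Fl_def)
  also have "sorted_list_of_set (set xs) = xs"
    using assms strict_sorted_iff by (intro sorted_list_of_set.idem_if_sorted_distinct) auto
  finally show ?thesis using Cons by simp
qed simp

definition column_list :: "nat list list \<Rightarrow> bool" where
  "column_list cs \<longleftrightarrow> (\<forall>c\<in>set cs. sorted_wrt (<) c \<and> c \<noteq> [])"

text \<open>Counting from 0, column \<open>i\<close> of the old tableau sits at index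
  \<open>m - Suc i\<close>, so the new row at index \<open>m\<close> is next to column 0. The
  operator \<open>opF (m - 1)\<close> inserts it there and leaves the bumped entries at index
  \<open>m - 1\<close>, next to the following column.\<close>

lemma col_inserts_row:
  assumes "column_list cs" "length cs \<le> m" "\<And>i. i < m \<Longrightarrow> X (m - Suc i) = st (map set cs) i"
    and "finite (X m)"
  shows "column_list (col_inserts cs (sorted_list_of_set (X m)))
    \<and> length (col_inserts cs (sorted_list_of_set (X m))) \<le> Suc m
    \<and> (\<forall>i\<le>m. foldr opF [0..<m] X (m - i) = st (map set (col_inserts cs (sorted_list_of_set (X m)))) i)"
  using assms
proof (induction m arbitrary: cs X)
  case 0
  then show ?case by (auto simp: col_inserts_Nil column_list_def st_def)
next
  case (Suc m)
  let ?b = "X (Suc m)" and ?a = "X m"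
  let ?X = "opF m X"
  have a: "?a = st (map set cs) 0" using Suc.prems(3)[of 0] by simp
  have fa: "finite ?a" unfolding a by (cases cs) (auto simp: st_def)
  have X: "?X m = Fl ?a ?b" "?X (Suc m) = Fr ?a ?b" "\<And>k. k < m \<Longrightarrow> ?X k = X k"
    by (auto simp: act_def)
  let ?R' = "col_inserts (tl cs) (sorted_list_of_set (?X m))"
  let ?R = "col_inserts cs (sorted_list_of_set ?b)"
  have R': "column_list ?R' \<and> length ?R' \<le> Suc m \<and> (\<forall>i\<le>m. foldr opF [0..<m] ?X (m - i) = st (map set ?R') i)"
  proof (rule Suc.IH)
    show "column_list (tl cs)" using Suc.prems(1) by (cases cs) (auto simp: column_list_def)
    show "length (tl cs) \<le> m" using Suc.prems(2) by simp
    show "finite (?X m)" using fa by (simp add: X Fl_def)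
    fix i assume "i < m"
    then have "?X (m - Suc i) = X (Suc m - Suc (Suc i))" by (subst X(3)) auto
    also have "\<dots> = st (map set cs) (Suc i)" using Suc.prems(3)[of "Suc i"] \<open>i < m\<close> by simp
    also have "\<dots> = st (map set (tl cs)) i" by (cases cs) (auto simp: st_def)
    finally show "?X (m - Suc i) = st (map set (tl cs)) i" .
  qed
  have top: "foldr opF [0..<m] Y (Suc m) = Y (Suc m)" for Y
  proof -
    have "k \<le> m \<Longrightarrow> foldr opF [0..<k] Y (Suc m) = Y (Suc m)" for k Y
      by (induction k arbitrary: Y) (auto simp: act_def)
    then show ?thesis by simp
  qed
  have so: "sorted_wrt (<) (sorted_list_of_set ?b)" by simp
  have R: "column_list ?R \<and> length ?R \<le> Suc (Suc m) \<and> st (map set ?R) 0 = Fr ?a ?b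
     \<and> (\<forall>i. st (map set ?R) (Suc i) = st (map set ?R') i)"
  proof (cases cs)
    case Nil
    then have e: "?a = {}" using a by (simp add: st_def)
    have "?R' = []" using Nil by (simp add: X e Fl_def)
    then show ?thesis
      unfolding Nil col_inserts_Nil[OF so] using Suc.prems(4)
      by (auto simp: e Fr_def st_def column_list_def)
  next
    case (Cons c cs')
    have c: "c = sorted_list_of_set ?a" "?a \<noteq> {}"
      using Suc.prems(1) Cons a strict_sorted_iff[of c]
      by (auto simp: st_def column_list_def sorted_list_of_set.idem_if_sorted_distinct)
    have fr: "finite (Fr ?a ?b)" using fa Suc.prems(4) finite_subset[OF unm_close_subset(1)] by (auto simp: Fr_def)
    have ne: "Fr ?a ?b \<noteq> {}" using c(2) by (cases "?b = {}") (auto simp: Fr_def)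
    have "?R = sorted_list_of_set (Fr ?a ?b) # ?R'"
      using col_inserts_Cons[OF fa so, of cs'] Cons c Suc.prems(4) by (simp add: X)
    then show ?thesis using R' fr ne by (auto simp: st_def column_list_def)
  qed
  have "foldr opF [0..<Suc m] X (Suc m - i) = st (map set ?R) i" if "i \<le> Suc m" for i
  proof (cases i)
    case 0
    then show ?thesis using R top[of ?X] X(2) by simp
  next
    case (Suc k)
    then show ?thesis using R R' that by simp
  qed
  then show ?case using R by blast
qed

lemma chain_foldr: "chain f m x = foldr f [0..<Suc m] x"
  by (induction m arbitrary: x) auto

lemma col_inserts_rw:
  assumes "\<forall>b\<in>set M. finite b" "m < length M"
  shows "column_list (col_inserts [] (rw (take (Suc m) M)))
    \<and> length (col_inserts [] (rw (take (Suc m) M))) \<le> Suc m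
    \<and> (\<forall>i\<le>m. longest opF m (st M) (m - i) = st (map set (col_inserts [] (rw (take (Suc m) M)))) i)"
  using assms(2)
proof (induction m)
  case 0
  then have "rw (take (Suc 0) M) = sorted_list_of_set (st M 0)" by (cases M) (auto simp: rw_def st_def)
  moreover have "finite (st M 0)" using 0 assms(1) by (simp add: st_def)
  ultimately show ?case
    using col_inserts_row[of "[]" 0 "st M"] by (simp add: column_list_def)
next
  case (Suc m)
  let ?cs = "col_inserts [] (rw (take (Suc m) M))"
  let ?Y = "longest opF m (st M)"
  have IH: "column_list ?cs" "length ?cs \<le> Suc m" "\<And>i. i \<le> m \<Longrightarrow> ?Y (m - i) = st (map set ?cs) i"
    using Suc by auto
  have Y: "?Y (Suc m) = M ! Suc m" using Suc.prems by (simp add: longest_act_beyond st_def)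
  have rw: "rw (take (Suc (Suc m)) M) = rw (take (Suc m) M) @ sorted_list_of_set (?Y (Suc m))"
    using Suc.prems by (simp add: rw_def take_Suc_conv_app_nth Y)
  have "finite (?Y (Suc m))" using Y assms(1) Suc.prems by simp
  then show ?case
    using col_inserts_row[of ?cs "Suc m" ?Y] IH by (simp add: rw chain_foldr del: upt_Suc)
qed

lemma tab_columns:
  assumes "\<forall>b\<in>set M. finite b" "\<And>i. i < length M \<Longrightarrow> longest opF (length M - 1) (st M) i \<noteq> {}"
  shows "tab M = cols_to_rows
    (map (\<lambda>i. sorted_list_of_set (longest opF (length M - 1) (st M) (length M - Suc i))) [0..<length M])"
proof (cases "M = []")
  case True
  then show ?thesis by (simp add: tab_def Icol_def rw_def)
next
  case False
  define m where "m = length M - 1"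
  have L: "length M = Suc m" using False by (simp add: m_def)
  let ?R = "col_inserts [] (rw M)" and ?Y = "longest opF m (st M)"
  have R: "column_list ?R" "length ?R \<le> Suc m" "\<And>i. i \<le> m \<Longrightarrow> ?Y (m - i) = st (map set ?R) i"
    using col_inserts_rw[OF assms(1), of m] L by auto
  \<comment> \<open>Index 0 of the state holds the last column; as it is nonempty, all
    \<open>Suc m\<close> columns are present in the list.\<close>
  have "st (map set ?R) m \<noteq> {}" using assms(2)[of 0] R(3)[of m] L by simp
  then have len: "length ?R = Suc m" using R(2) by (auto simp: st_def split: if_splits)
  have "?R = map (\<lambda>i. sorted_list_of_set (?Y (m - i))) [0..<Suc m]"
  proof (rule nth_equalityI)
    fix i assume i: "i < length ?R"
    then have "sorted_wrt (<) (?R ! i)" using R(1) by (simp add: column_list_def)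
    then have "sorted_list_of_set (set (?R ! i)) = ?R ! i"
      using strict_sorted_iff by (intro sorted_list_of_set.idem_if_sorted_distinct) auto
    then show "?R ! i = map (\<lambda>i. sorted_list_of_set (?Y (m - i))) [0..<Suc m] ! i"
      using i len R(3)[of i] by (simp add: st_def del: upt_Suc)
  qed (simp add: len)
  then show ?thesis by (simp add: tab_def Icol_def L)
qed

section \<open>Major index\<close>

text \<open>For finite rows this is the Hall condition for pairing the balls of the upper row
  \<open>b\<close> injectively with balls of \<open>a\<close> weakly to their right.\<close>

definition suffix_dom :: "nat set \<Rightarrow> nat set \<Rightarrow> bool" where
  "suffix_dom a b \<longleftrightarrow> (\<forall>y. card (b \<inter> {y..}) \<le> card (a \<inter> {y..}))"

lemma suffix_dom_card: "suffix_dom a b \<Longrightarrow> card b \<le> card a"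
  unfolding suffix_dom_def by (drule spec[of _ 0]) (simp add: atLeast_0)

lemma card_suffix:
  assumes "a \<subseteq> {..<N}" "y \<le> N"
  shows "int (card (a \<inter> {y..})) = pcount a N - pcount a y"
proof -
  have "a \<inter> {..<N} = (a \<inter> {..<y}) \<union> (a \<inter> {y..})" using assms by auto
  moreover have "finite a" using assms(1) finite_subset by blast
  ultimately have "card (a \<inter> {..<N}) = card (a \<inter> {..<y}) + card (a \<inter> {y..})"
    by (simp add: card_Un_disjoint disjoint_iff)
  then show ?thesis by (simp add: pcount_def)
qed

text \<open>In terms of heights, both sides say that the path never exceeds its final value;
  otherwise the last column above that value would hold an unmatched opening bracket.\<close>

lemma unm_open_empty_iff:
  assumes "a \<subseteq> {..<N}" "b \<subseteq> {..<N}"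
  shows "unm_open a b = {} \<longleftrightarrow> suffix_dom a b"
proof -
  let ?h = "hgt a b"
  have "suffix_dom a b \<longleftrightarrow> (\<forall>y\<le>N. ?h y \<le> ?h N)"
  proof -
    have *: "card (b \<inter> {y..}) \<le> card (a \<inter> {y..}) \<longleftrightarrow> ?h y \<le> ?h N" if "y \<le> N" for y
      using card_suffix[OF assms(1) that] card_suffix[OF assms(2) that] by (simp add: hgt_def) linarith
    have "b \<inter> {y..} = {}" if "\<not> y \<le> N" for y using assms that by auto
    then have "card (b \<inter> {y..}) \<le> card (a \<inter> {y..})" if "\<not> y \<le> N" for y using that by simp
    then show ?thesis unfolding suffix_dom_def using * by blast
  qed
  also have "\<dots> \<longleftrightarrow> unm_open a b = {}"
  proof
    assume *: "\<forall>y\<le>N. ?h y \<le> ?h N"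
    have "j \<notin> unm_open a b" for j
    proof
      assume j: "j \<in> unm_open a b"
      then have "j < N" using unm_open_subset(1) assms by blast
      then have "?h N < ?h j" using j unfolding unm_open_def by blast
      then show False using *[rule_format, of j] \<open>j < N\<close> by linarith
    qed
    then show "unm_open a b = {}" by blast
  next
    assume e: "unm_open a b = {}"
    show "\<forall>y\<le>N. ?h y \<le> ?h N"
    proof (rule ccontr)
      assume "\<not> ?thesis"
      then obtain y0 where y0: "y0 \<le> N" "?h N < ?h y0" by auto
      define y where "y = (GREATEST y. y \<le> N \<and> ?h N < ?h y)"
      have y: "y \<le> N" "?h N < ?h y"
        using GreatestI_nat[of "\<lambda>y. y \<le> N \<and> ?h N < ?h y" y0 N] y0 by (auto simp: y_def)
      have le: "z \<le> y" if "z \<le> N" "?h N < ?h z" for z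
        unfolding y_def using Greatest_le_nat[of "\<lambda>x. x \<le> N \<and> ?h N < ?h x" z N] that by auto
      have "y < N" using y by (cases "y = N") auto
      moreover have "?h z < ?h y" if "y < z" "z \<le> N" for z
        using le[of z] that y by linarith
      ultimately have "y \<in> unm_open a b" using mem_unm_open[OF assms] by blast
      then show False using e by blast
    qed
  qed
  finally show ?thesis by blast
qed

section \<open>Wrapping in the greedy pairing\<close>

lemma pair_row_mono: "m \<le> snd (pair_row r B ps lab m)"
proof (induction ps arbitrary: lab m)
  case (Cons p ps)
  obtain l j where p: "p = (l, j)" by force
  define t where "t = (let free = {c \<in> B. lab c = None} in
     if \<exists>c\<in>free. j \<le> c then Min {c \<in> free. j \<le> c} else Min free)"
  have "pair_row r B (p # ps) lab m = pair_row r B ps (lab(t \<mapsto> l)) (if t < j then m + (l + 1 - r) else m)"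
    unfolding p pair_row.simps Let_def t_def ..
  moreover have "m \<le> (if t < j then m + (l + 1 - r) else m)" by simp
  ultimately show ?case using Cons.IH order_trans by metis
qed simp

lemma pair_row_labels:
  "fst (pair_row r B ps lab m) c = Some l \<Longrightarrow> lab c = Some l \<or> l \<in> fst ` set ps"
proof (induction ps arbitrary: lab m)
  case (Cons p ps)
  obtain l' j where p: "p = (l', j)" by force
  define t where "t = (let free = {c \<in> B. lab c = None} in
     if \<exists>c\<in>free. j \<le> c then Min {c \<in> free. j \<le> c} else Min free)"
  have "pair_row r B (p # ps) lab m = pair_row r B ps (lab(t \<mapsto> l')) (if t < j then m + (l' + 1 - r) else m)"
    unfolding p pair_row.simps Let_def t_def ..
  then have "(lab(t \<mapsto> l')) c = Some l \<or> l \<in> fst ` set ps"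
    using Cons.IH Cons.prems by metis
  then show ?case by (auto simp: p split: if_splits)
qed simp

text \<open>Only a suffix starting after \<open>j\<close> and not after \<open>t\<close> is at risk,
  since it loses \<open>t\<close> but not \<open>j\<close>. As \<open>A\<close> has no element from
  \<open>j\<close> up to \<open>t - 1\<close>, this suffix of \<open>A\<close> equals the one from
  \<open>j\<close>, which dominated \<open>j\<close> in addition.\<close>

lemma suffix_dom_remove:
  assumes "finite A" "finite B" "suffix_dom A B" "j \<in> B" "t \<in> A" "j \<le> t"
    and first: "\<And>c. c \<in> A \<Longrightarrow> j \<le> c \<Longrightarrow> t \<le> c"
  shows "suffix_dom (A - {t}) (B - {j})"
  unfolding suffix_dom_def
proof
  fix y
  have D: "card (B \<inter> {z..}) \<le> card (A \<inter> {z..})" for z using assms(3) by (simp add: suffix_dom_def)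
  have rem: "(A - {t}) \<inter> {y..} = (if y \<le> t then A \<inter> {y..} - {t} else A \<inter> {y..})"
    "(B - {j}) \<inter> {y..} = (if y \<le> j then B \<inter> {y..} - {j} else B \<inter> {y..})" by auto
  have cA: "card ((A - {t}) \<inter> {y..}) = card (A \<inter> {y..}) - (if y \<le> t then 1 else 0)"
    unfolding rem using assms by (auto simp: card_Diff_singleton_if)
  have cB: "card ((B - {j}) \<inter> {y..}) = card (B \<inter> {y..}) - (if y \<le> j then 1 else 0)"
    unfolding rem using assms by (auto simp: card_Diff_singleton_if)
  show "card ((B - {j}) \<inter> {y..}) \<le> card ((A - {t}) \<inter> {y..})"
  proof (cases "y \<le> t \<and> \<not> y \<le> j")
    case True
    have "A \<inter> {y..} = A \<inter> {j..}" using True first by fastforce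
    moreover have "insert j (B \<inter> {y..}) \<subseteq> B \<inter> {j..}" using True assms(4) by auto
    then have "card (insert j (B \<inter> {y..})) \<le> card (B \<inter> {j..})"
      using assms(2) by (intro card_mono) auto
    moreover have "card (insert j (B \<inter> {y..})) = Suc (card (B \<inter> {y..}))"
      using True assms(2) by (subst card_insert_disjoint) auto
    ultimately show ?thesis using D[of j] True unfolding cA cB by auto
  next
    case False
    then show ?thesis using D[of y] assms(6) unfolding cA cB by auto
  qed
qed

text \<open>Dominance by the free balls survives each pairing, whichever ball comes next; hence no
  order prescribed by the labels can cause a wrap.\<close>

lemma pair_row_nowrap:
  assumes "finite B" "distinct (map snd ps)" "suffix_dom {c \<in> B. lab c = None} (snd ` set ps)"
  shows "snd (pair_row r B ps lab m) = m"
  using assms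
proof (induction ps arbitrary: lab m)
  case (Cons p ps)
  obtain l j where p: "p = (l, j)" by force
  note prems = Cons.prems[unfolded p]
  let ?A = "{c \<in> B. lab c = None}" and ?P = "snd ` set ((l, j) # ps)"
  have "0 < card (?P \<inter> {j..})" by (auto simp: card_gt_0_iff)
  also have "\<dots> \<le> card (?A \<inter> {j..})" using prems(3) unfolding suffix_dom_def by blast
  finally have ne: "\<exists>c\<in>?A. j \<le> c" by (auto simp: card_gt_0_iff)
  define t where "t = Min {c \<in> ?A. j \<le> c}"
  have "t \<in> {c \<in> ?A. j \<le> c}" unfolding t_def using ne prems(1) by (intro Min_in) auto
  then have t: "t \<in> ?A" "j \<le> t" by auto
  have first: "t \<le> c" if "c \<in> ?A" "j \<le> c" for c unfolding t_def using that prems(1) by (intro Min_le) auto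
  have "suffix_dom (?A - {t}) (?P - {j})"
    using prems t first by (intro suffix_dom_remove) auto
  moreover have "?A - {t} = {c \<in> B. (lab(t \<mapsto> l)) c = None}" by auto
  moreover have "?P - {j} = snd ` set ps" using prems(2) by auto
  ultimately have d: "suffix_dom {c \<in> B. (lab(t \<mapsto> l)) c = None} (snd ` set ps)" by simp
  have "pair_row r B ((l, j) # ps) lab m = pair_row r B ps (lab(t \<mapsto> l)) m"
    unfolding pair_row.simps Let_def if_P[OF ne] t_def[symmetric] using t(2) by simp
  moreover have "snd (pair_row r B ps (lab(t \<mapsto> l)) m) = m"
    by (rule Cons.IH[OF prems(1) _ d]) (use prems(2) in simp)
  ultimately show ?case by (simp add: p)
qed simp

text \<open>A wrap adds \<open>l + 1 - r\<close>, which is positive because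
  \<open>r \<le> l\<close>, so an unchanged total means that every pairing goes weakly to the right.
  The length bound keeps a free ball available, so \<open>Min\<close> is never taken of an empty
  set.\<close>

lemma pair_row_nowrap_conv:
  assumes "finite B" "\<forall>p\<in>set ps. r \<le> fst p" "length ps \<le> card {c \<in> B. lab c = None}"
    and "snd (pair_row r B ps lab m) = m"
  shows "card (snd ` set ps \<inter> {y..}) \<le> card ({c \<in> B. lab c = None} \<inter> {y..})"
  using assms
proof (induction ps arbitrary: lab m)
  case (Cons p ps)
  obtain l j where p: "p = (l, j)" by force
  let ?A = "{c \<in> B. lab c = None}"
  define t where "t = (if \<exists>c\<in>?A. j \<le> c then Min {c \<in> ?A. j \<le> c} else Min ?A)"
  have fin: "finite ?A" using Cons.prems by simp
  have ne: "?A \<noteq> {}"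
  proof
    assume "?A = {}"
    then have "card ?A = 0" by (simp only: card.empty)
    then show False using Cons.prems(3) by simp
  qed
  have eq: "pair_row r B (p # ps) lab m = pair_row r B ps (lab(t \<mapsto> l)) (if t < j then m + (l + 1 - r) else m)"
    unfolding p pair_row.simps Let_def t_def ..
  have rl: "r \<le> l" using Cons.prems(2) p by simp
  have jt: "\<not> t < j"
  proof
    assume "t < j"
    then have "m + (l + 1 - r) \<le> snd (pair_row r B (p # ps) lab m)"
      unfolding eq using pair_row_mono by simp
    then show False using Cons.prems(4) rl by simp
  qed
  have tA: "t \<in> ?A"
  proof (cases "\<exists>c\<in>?A. j \<le> c")
    case True
    then have "Min {c \<in> ?A. j \<le> c} \<in> {c \<in> ?A. j \<le> c}" using Cons.prems(1) by (intro Min_in) auto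
    then show ?thesis using True by (auto simp: t_def)
  next
    case False
    then show ?thesis unfolding t_def if_not_P[OF False] by (intro Min_in[OF fin ne])
  qed
  have A': "{c \<in> B. (lab(t \<mapsto> l)) c = None} = ?A - {t}" by auto
  have c': "card (?A - {t}) = card ?A - 1" using tA fin by (simp add: card_Diff_singleton)
  have IH: "card (snd ` set ps \<inter> {y..}) \<le> card ((?A - {t}) \<inter> {y..})"
    unfolding A'[symmetric]
  proof (rule Cons.IH)
    show "length ps \<le> card {c \<in> B. (lab(t \<mapsto> l)) c = None}"
      unfolding A' c' using Cons.prems(3) by simp
    show "snd (pair_row r B ps (lab(t \<mapsto> l)) m) = m" using Cons.prems(4) eq jt by simp
  qed (use Cons.prems in auto)
  show ?case
  proof (cases "y \<le> j")
    case True
    then have "snd ` set (p # ps) \<inter> {y..} = insert j (snd ` set ps \<inter> {y..})" using p by auto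
    then have "card (snd ` set (p # ps) \<inter> {y..}) \<le> Suc (card (snd ` set ps \<inter> {y..}))"
      by (simp add: card_insert_if)
    moreover have "?A \<inter> {y..} = insert t ((?A - {t}) \<inter> {y..})" using True jt tA by auto
    then have "card (?A \<inter> {y..}) = Suc (card ((?A - {t}) \<inter> {y..}))" using fin by simp
    ultimately show ?thesis using IH by simp
  next
    case False
    then have "snd ` set (p # ps) \<inter> {y..} = snd ` set ps \<inter> {y..}" using p by auto
    moreover have "card ((?A - {t}) \<inter> {y..}) \<le> card (?A \<inter> {y..})" using fin by (intro card_mono) auto
    ultimately show ?thesis using IH by simp
  qed
qed simp

text \<open>\<open>maj_step\<close> lists balls label by label from \<open>length M\<close> down to
  \<open>r\<close>; the list contains every ball of the row only if the labels stay in that range,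
  which is why this is carried along.\<close>

lemma maj_step_nowrap:
  assumes "finite (M ! (r - 1))" "finite (M ! (r - 2))" "card (M ! (r - 1)) \<le> card (M ! (r - 2))"
    and "r \<le> length M" "\<forall>j l. fst s j = Some l \<longrightarrow> r \<le> l \<and> l \<le> length M"
  shows "snd s \<le> snd (maj_step M r s)"
    and "snd (maj_step M r s) = snd s \<longleftrightarrow> suffix_dom (M ! (r - 2)) (M ! (r - 1))"
    and "fst (maj_step M r s) j = Some l \<Longrightarrow> r \<le> l \<and> l \<le> length M"
proof -
  let ?B = "M ! (r - 1)"
  define lab where "lab = (\<lambda>j. if j \<in> ?B \<and> fst s j = None then Some r else fst s j)"
  define ps where "ps = concat (map (\<lambda>l. map (\<lambda>j. (l, j)) (sorted_list_of_set {j \<in> ?B. lab j = Some l}))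
                           (rev [r..<Suc (length M)]))"
  have step: "maj_step M r s = pair_row r (M ! (r - 2)) ps Map.empty (snd s)"
    unfolding maj_step_def Let_def ps_def lab_def ..
  have lab: "r \<le> l \<and> l \<le> length M" if "lab j = Some l" for j l
    using that assms(4,5) by (auto simp: lab_def split: if_splits)
  have set_ps: "set ps = {(l, j). j \<in> ?B \<and> lab j = Some l}"
    using assms(1) lab by (fastforce simp: ps_def simp del: upt_Suc)
  have "\<exists>l. lab j = Some l" if "j \<in> ?B" for j using that by (auto simp: lab_def)
  then have snd_ps: "snd ` set ps = ?B" unfolding set_ps by force
  have "map snd ps = concat (map (\<lambda>l. sorted_list_of_set {j \<in> ?B. lab j = Some l}) (rev [r..<Suc (length M)]))"
    by (simp add: ps_def map_concat comp_def del: upt_Suc)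
  moreover have "distinct (concat (map (\<lambda>l. sorted_list_of_set {j \<in> ?B. lab j = Some l}) ls))"
    if "distinct ls" for ls using that assms(1) by (induction ls) auto
  ultimately have dist: "distinct (map snd ps)" by (simp del: upt_Suc)
  then have len: "length ps = card ?B"
    using distinct_card[OF dist] snd_ps by simp
  show "snd s \<le> snd (maj_step M r s)" unfolding step by (rule pair_row_mono)
  show "snd (maj_step M r s) = snd s \<longleftrightarrow> suffix_dom (M ! (r - 2)) ?B"
  proof
    assume "suffix_dom (M ! (r - 2)) ?B"
    then show "snd (maj_step M r s) = snd s"
      unfolding step using assms(2) dist snd_ps by (intro pair_row_nowrap) auto
  next
    assume *: "snd (maj_step M r s) = snd s"
    have "\<forall>p\<in>set ps. r \<le> fst p" using lab by (auto simp: set_ps)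
    moreover have "snd (pair_row r (M ! (r - 2)) ps Map.empty (snd s)) = snd s" using * step by simp
    ultimately have "card (snd ` set ps \<inter> {y..}) \<le> card (M ! (r - 2) \<inter> {y..})" for y
      using pair_row_nowrap_conv[of "M ! (r - 2)" ps r Map.empty "snd s" y] assms(2,3) len by simp
    then show "suffix_dom (M ! (r - 2)) ?B" by (simp add: suffix_dom_def snd_ps)
  qed
  show "r \<le> l \<and> l \<le> length M" if "fst (maj_step M r s) j = Some l"
    using pair_row_labels[OF that[unfolded step]] lab by (auto simp: set_ps)
qed

lemma maj_eq_0_iff:
  assumes "\<forall>B\<in>set M. finite B" "\<And>i. Suc i < length M \<Longrightarrow> card (M ! Suc i) \<le> card (M ! i)"
  shows "maj M = 0 \<longleftrightarrow> (\<forall>i. Suc i < length M \<longrightarrow> suffix_dom (M ! i) (M ! Suc i))"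
proof -
  let ?S = "\<lambda>k. foldl (\<lambda>st r. maj_step M r st) (Map.empty, 0) (rev [k..<Suc (length M)])"
  have inv: "(\<forall>j l. fst (?S k) j = Some l \<longrightarrow> k \<le> l \<and> l \<le> length M) \<and>
     (snd (?S k) = 0 \<longleftrightarrow> (\<forall>r. k \<le> r \<and> r \<le> length M \<longrightarrow> suffix_dom (M ! (r - 2)) (M ! (r - 1))))"
    if "2 \<le> k" "k \<le> Suc (length M)" for k
    using that(2,1)
  proof (induction k rule: inc_induct)
    case (step k)
    \<comment> \<open>The fold runs from the top row downwards, so lowering \<open>k\<close> appends
      one step at its end.\<close>
    have S: "?S k = maj_step M k (?S (Suc k))"
      using step by (simp add: upt_conv_Cons del: upt_Suc)
    note IH0 = step.IH[OF le_SucI[OF step.prems]]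
    have IH: "\<forall>j l. fst (?S (Suc k)) j = Some l \<longrightarrow> k \<le> l \<and> l \<le> length M"
      using conjunct1[OF IH0] Suc_leD by blast
    have "k - 1 < length M" "k - 2 < length M" using step.prems step.hyps(2) by linarith+
    then have k: "finite (M ! (k - 1))" "finite (M ! (k - 2))" "k \<le> length M"
      using assms(1) step.hyps(2) nth_mem by (blast, blast, linarith)
    have "Suc (k - 2) = k - 1" using step.prems by simp
    then have c: "card (M ! (k - 1)) \<le> card (M ! (k - 2))" using assms(2)[of "k - 2"] step.prems k(3) by simp
    note facts = maj_step_nowrap(1,2)[of M k "?S (Suc k)", OF k(1,2) c k(3) IH]
    have "snd (?S k) = 0 \<longleftrightarrow> snd (?S (Suc k)) = 0 \<and> suffix_dom (M ! (k - 2)) (M ! (k - 1))"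
      unfolding S using facts(1,2) by auto
    also have "\<dots> \<longleftrightarrow> (\<forall>r. k \<le> r \<and> r \<le> length M \<longrightarrow> suffix_dom (M ! (r - 2)) (M ! (r - 1)))"
    proof -
      have "(\<forall>r. k \<le> r \<and> r \<le> length M \<longrightarrow> Q r) \<longleftrightarrow> Q k \<and> (\<forall>r. Suc k \<le> r \<and> r \<le> length M \<longrightarrow> Q r)" for Q
        using k(3) by (metis Suc_le_eq le_eq_less_or_eq)
      from this[of "\<lambda>r. suffix_dom (M ! (r - 2)) (M ! (r - 1))"] show ?thesis
        unfolding conjunct2[OF IH0] by (simp only: conj_commute)
    qed
    finally have zero: "snd (?S k) = 0 \<longleftrightarrow> (\<forall>r. k \<le> r \<and> r \<le> length M \<longrightarrow> suffix_dom (M ! (r - 2)) (M ! (r - 1)))" .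
    have "\<forall>j l. fst (?S k) j = Some l \<longrightarrow> k \<le> l \<and> l \<le> length M"
    proof (intro allI impI)
      fix j l assume "fst (?S k) j = Some l"
      then show "k \<le> l \<and> l \<le> length M"
        unfolding S by (rule maj_step_nowrap(3)[OF k(1,2) c k(3) IH])
    qed
    then show ?case using zero by (rule conjI)
  qed auto
  show ?thesis
  proof (cases "M = []")
    case False
    then have "2 \<le> Suc (length M)" by (simp add: Suc_le_eq)
    then have "maj M = 0 \<longleftrightarrow> (\<forall>r. 2 \<le> r \<and> r \<le> length M \<longrightarrow> suffix_dom (M ! (r - 2)) (M ! (r - 1)))"
      unfolding maj_def using inv[of 2] by blast
    also have "\<dots> \<longleftrightarrow> (\<forall>i. Suc i < length M \<longrightarrow> suffix_dom (M ! i) (M ! Suc i))"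
    proof (intro iffI allI impI)
      fix i assume "\<forall>r. 2 \<le> r \<and> r \<le> length M \<longrightarrow> suffix_dom (M ! (r - 2)) (M ! (r - 1))" "Suc i < length M"
      from this(1)[rule_format, of "Suc (Suc i)"] this(2)
      show "suffix_dom (M ! i) (M ! Suc i)" by simp
    next
      fix r assume "\<forall>i. Suc i < length M \<longrightarrow> suffix_dom (M ! i) (M ! Suc i)" and r: "2 \<le> r \<and> r \<le> length M"
      have "Suc (r - 2) < length M" using r by linarith
      from \<open>\<forall>i. _\<close>[rule_format, OF this] have "suffix_dom (M ! (r - 2)) (M ! Suc (r - 2))" .
      moreover have "Suc (r - 2) = r - 1" using r by linarith
      ultimately show "suffix_dom (M ! (r - 2)) (M ! (r - 1))" by simp
    qed
    finally show ?thesis .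
  qed (simp add: maj_def)
qed

section \<open>Row sizes\<close>

definition sizes :: "nat \<Rightarrow> (nat \<Rightarrow> nat set) \<Rightarrow> nat list" where
  "sizes K X = map (\<lambda>i. card (X i)) [0..<K]"

definition spread :: "nat list \<Rightarrow> nat" where
  "spread xs = (\<Sum>x\<leftarrow>xs. x\<^sup>2)"

text \<open>The second clause is what a round trip exploits: growth in both directions makes the
  spreads agree, and then the multisets.\<close>

definition grows :: "nat list \<Rightarrow> nat list \<Rightarrow> bool" where
  "grows xs ys \<longleftrightarrow> spread xs \<le> spread ys \<and> (spread xs = spread ys \<longrightarrow> mset xs = mset ys)"

lemma grows_trans: "grows xs ys \<Longrightarrow> grows ys zs \<Longrightarrow> grows xs zs"
  unfolding grows_def by auto

lemma grows_antisym: "grows xs ys \<Longrightarrow> grows ys xs \<Longrightarrow> mset xs = mset ys"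
  by (auto simp: grows_def)

text \<open>With \<open>p = x + d\<close> and \<open>x = q + e\<close> one gets
  \<open>y = q + d\<close>, and the sums of squares differ by \<open>2 * d * e\<close>; equality
  forces \<open>d = 0\<close> or \<open>e = 0\<close>.\<close>

lemma pair_spread:
  fixes x y p q :: nat
  assumes "p + q = x + y" "x \<le> p" "y \<le> p"
  shows "x\<^sup>2 + y\<^sup>2 \<le> p\<^sup>2 + q\<^sup>2" and "x\<^sup>2 + y\<^sup>2 = p\<^sup>2 + q\<^sup>2 \<Longrightarrow> x = p \<and> y = q \<or> x = q \<and> y = p"
proof -
  obtain d where d: "p = x + d" using assms(2) le_Suc_ex by blast
  then have y: "y = q + d" using assms(1) by simp
  then have "q \<le> x" using assms(3) d by simp
  then obtain e where e: "x = q + e" using le_Suc_ex by blast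
  have eq: "p\<^sup>2 + q\<^sup>2 = x\<^sup>2 + y\<^sup>2 + 2 * d * e"
    unfolding d y e by (simp add: power2_eq_square algebra_simps)
  then show "x\<^sup>2 + y\<^sup>2 \<le> p\<^sup>2 + q\<^sup>2" by simp
  assume "x\<^sup>2 + y\<^sup>2 = p\<^sup>2 + q\<^sup>2"
  then have "d = 0 \<or> e = 0" using eq by simp
  then show "x = p \<and> y = q \<or> x = q \<and> y = p" using d e y by auto
qed

lemma grows_act:
  assumes "Suc i < K"
    and "card (l (X i) (X (Suc i))) + card (r (X i) (X (Suc i))) = card (X i) + card (X (Suc i))"
    and "max (card (X i)) (card (X (Suc i))) \<le> max (card (l (X i) (X (Suc i)))) (card (r (X i) (X (Suc i))))"
  shows "grows (sizes K X) (sizes K (act l r i X))"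
proof -
  let ?x = "card (X i)" and ?y = "card (X (Suc i))"
  let ?p = "card (l (X i) (X (Suc i)))" and ?q = "card (r (X i) (X (Suc i)))"
  have "[0..<K] = [0..<i] @ [i..<K]" using upt_add_eq_append[of 0 i "K - i"] assms(1) by simp
  moreover have "[i..<K] = i # Suc i # [Suc (Suc i)..<K]" using assms(1) by (simp add: upt_conv_Cons)
  ultimately have K: "[0..<K] = [0..<i] @ i # Suc i # [Suc (Suc i)..<K]" by simp
  define A where "A = map (\<lambda>i. card (X i)) [0..<i]"
  define B where "B = map (\<lambda>i. card (X i)) [Suc (Suc i)..<K]"
  have s1: "sizes K X = A @ ?x # ?y # B" by (simp add: sizes_def K A_def B_def)
  have s2: "sizes K (act l r i X) = A @ ?p # ?q # B" by (auto simp: sizes_def K A_def B_def act_def)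
  have "?x\<^sup>2 + ?y\<^sup>2 \<le> ?p\<^sup>2 + ?q\<^sup>2 \<and>
     (?x\<^sup>2 + ?y\<^sup>2 = ?p\<^sup>2 + ?q\<^sup>2 \<longrightarrow> ?x = ?p \<and> ?y = ?q \<or> ?x = ?q \<and> ?y = ?p)"
  proof (cases "?q \<le> ?p")
    case True
    then show ?thesis using pair_spread[of ?p ?q ?x ?y] assms(2,3) by auto
  next
    case False
    then show ?thesis using pair_spread[of ?q ?p ?x ?y] assms(2,3) by auto
  qed
  then show ?thesis by (auto simp: grows_def spread_def s1 s2)
qed

lemma grows_longest:
  assumes "zero_hecke f D" "\<And>i X. Suc i < K \<Longrightarrow> X \<in> D \<Longrightarrow> grows (sizes K X) (sizes K (f i X))"
    and "X \<in> D" "m < K"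
  shows "grows (sizes K X) (sizes K (longest f m X))"
proof -
  interpret zero_hecke f D by fact
  have 1: "grows (sizes K Y) (sizes K (chain f k Y))" if "Y \<in> D" "Suc k < K" for k Y
    using that
  proof (induction k arbitrary: Y)
    case (Suc k)
    then show ?case using assms(2)[of "Suc k" Y] closed grows_trans by auto
  qed (use assms(2) in auto)
  show ?thesis using assms(4)
  proof (induction m)
    case (Suc m)
    then show ?case using 1[of "longest f m X" m] longest_closed[OF assms(3)] grows_trans by auto
  qed (simp add: grows_def)
qed

text \<open>The path runs from 0 to \<open>card a - card b\<close>, so at least
  \<open>card b - card a\<close> opening brackets are unmatched and move down. Thus the larger of
  the two sizes cannot drop.\<close>

lemma card_E:
  assumes "a \<subseteq> {..<N}" "b \<subseteq> {..<N}"
  shows "card (El a b) + card (Er a b) = card a + card b" "card a \<le> card (El a b)" "card b \<le> card (El a b)"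
proof -
  have fin: "finite a" "finite b" "finite (unm_open a b)"
    using assms finite_subset[of _ "{..<N}"] unm_open_subset(1)[of a b] by blast+
  have U: "card (El a b) = card a + card (unm_open a b)"
    unfolding El_def using fin unm_open_subset(2)[of a b] by (intro card_Un_disjoint) auto
  have "card (Er a b) = card b - card (unm_open a b)" "card (unm_open a b) \<le> card b"
    unfolding Er_def using fin unm_open_subset(1)[of a b] by (auto intro: card_Diff_subset card_mono)
  then show "card (El a b) + card (Er a b) = card a + card b" "card a \<le> card (El a b)" using U by auto
  have "int (card (unm_open a b)) = pcount (unm_open a b) N"
    using fin unm_open_subset(1)[of a b] assms by (intro pcount_eq_card[symmetric]) auto
  also have "\<dots> = rmax (hgt a b) 0 N - hgt a b N" using pcount_unm_open[OF assms, of N] by simp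
  also have "\<dots> \<ge> - hgt a b N" using rmax_ge[of 0 0 N "hgt a b"] by simp
  finally show "card b \<le> card (El a b)"
    using pcount_eq_card[of a N N] pcount_eq_card[of b N N] fin assms U by (simp add: hgt_def)
qed

lemma card_F:
  assumes "a \<subseteq> {..<N}" "b \<subseteq> {..<N}"
  shows "card (Fl a b) + card (Fr a b) = card a + card b" "card a \<le> card (Fr a b)" "card b \<le> card (Fr a b)"
proof -
  have fin: "finite a" "finite b" "finite (unm_close a b)"
    using assms finite_subset[of _ "{..<N}"] unm_close_subset(1)[of a b] by blast+
  have U: "card (Fr a b) = card b + card (unm_close a b)"
    unfolding Fr_def using fin unm_close_subset(2)[of a b] by (intro card_Un_disjoint) auto
  have "card (Fl a b) = card a - card (unm_close a b)" "card (unm_close a b) \<le> card a"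
    unfolding Fl_def using fin unm_close_subset(1)[of a b] by (auto intro: card_Diff_subset card_mono)
  then show "card (Fl a b) + card (Fr a b) = card a + card b" "card b \<le> card (Fr a b)" using U by auto
  have "int (card (unm_close a b)) = pcount (unm_close a b) N"
    using fin unm_close_subset(1)[of a b] assms by (intro pcount_eq_card[symmetric]) auto
  also have "\<dots> \<ge> hgt a b N" unfolding pcount_unm_close by (simp add: rmax_ge)
  finally show "card a \<le> card (Fr a b)"
    using pcount_eq_card[of a N N] pcount_eq_card[of b N N] fin assms U by (simp add: hgt_def)
qed

lemma grows_longest_E:
  assumes "X \<in> bdd_states N" "m < K"
  shows "grows (sizes K X) (sizes K (longest opE m X))"
proof (rule grows_longest[OF zero_hecke_E _ assms])
  fix i X assume "Suc i < K" "X \<in> bdd_states N"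
  then show "grows (sizes K X) (sizes K (opE i X))"
    using card_E[of "X i" N "X (Suc i)"] by (intro grows_act) (auto simp: bdd_states_def)
qed

lemma grows_longest_F:
  assumes "X \<in> bdd_states N" "m < K"
  shows "grows (sizes K X) (sizes K (longest opF m X))"
proof (rule grows_longest[OF zero_hecke_F _ assms])
  fix i X assume "Suc i < K" "X \<in> bdd_states N"
  then show "grows (sizes K X) (sizes K (opF i X))"
    using card_F[of "X i" N "X (Suc i)"] by (intro grows_act) (auto simp: bdd_states_def)
qed

lemma mset_sizes:
  assumes "X \<in> bdd_states N" "Y \<in> bdd_states N" "m < K" "longest opF m X = Y" "longest opE m Y = X"
  shows "mset (sizes K X) = mset (sizes K Y)"
  using grows_antisym grows_longest_F[OF assms(1,3)] grows_longest_E[OF assms(2,3)] unfolding assms(4,5) by blast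

lemma opF_fix: "opF i X = X \<longleftrightarrow> (\<forall>y. pcount (X i) y \<le> pcount (X (Suc i)) y)"
proof -
  let ?a = "X i" and ?b = "X (Suc i)"
  have "opF i X = X \<longleftrightarrow> unm_close ?a ?b = {}"
  proof
    assume "opF i X = X"
    from fun_cong[OF this, of "Suc i"] have "Fr ?a ?b = ?b" by (simp add: act_def)
    then show "unm_close ?a ?b = {}" using unm_close_subset(2)[of ?a ?b] by (auto simp: Fr_def)
  qed (auto simp: act_def Fl_def Fr_def)
  also have "\<dots> \<longleftrightarrow> (\<forall>y. hgt ?a ?b y \<le> 0)"
  proof
    assume e: "unm_close ?a ?b = {}"
    show "\<forall>y. hgt ?a ?b y \<le> 0"
    proof
      fix y
      have "rmax (hgt ?a ?b) 0 y = 0" using pcount_unm_close[of ?a ?b y] e by (simp add: pcount_def)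
      then show "hgt ?a ?b y \<le> 0" using rmax_ge[of 0 y y "hgt ?a ?b"] by simp
    qed
  next
    assume *: "\<forall>y. hgt ?a ?b y \<le> 0"
    have "rmax (hgt ?a ?b) 0 y = 0" for y
      using * rmax_ge[of 0 0 y "hgt ?a ?b"] by (intro antisym) (auto simp: rmax_le_iff)
    then have "pcount (unm_close ?a ?b) = pcount {}"
      unfolding fun_eq_iff pcount_unm_close by (simp add: pcount_def)
    then show "unm_close ?a ?b = {}" by (rule pcount_inject)
  qed
  finally show ?thesis by (simp add: hgt_def)
qed

text \<open>A monotone list is determined by its multiset. States fixed by all \<open>opF\<close>
  have increasing sizes and those fixed by all \<open>opE\<close> decreasing ones, hence the two
  readings of \<open>ds\<close>.\<close>

lemma sizes_eqI:
  assumes "mset (sizes K X) = mset ds" "sorted_wrt (\<ge>) ds" "length ds = K"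
  shows "(\<And>i. Suc i < K \<Longrightarrow> card (X i) \<le> card (X (Suc i))) \<Longrightarrow> i < K \<Longrightarrow> card (X i) = ds ! (K - Suc i)"
    and "(\<And>i. Suc i < K \<Longrightarrow> card (X (Suc i)) \<le> card (X i)) \<Longrightarrow> i < K \<Longrightarrow> card (X i) = ds ! i"
proof -
  have srt: "sorted (rev ds)" using assms(2) by (simp add: sorted_wrt_rev)
  {
    assume *: "\<And>i. Suc i < K \<Longrightarrow> card (X i) \<le> card (X (Suc i))" and i: "i < K"
    have "sorted (sizes K X)" using * by (auto simp: sorted_iff_nth_Suc sizes_def)
    then have "sizes K X = rev ds"
      using srt assms(1) by (metis mset_rev properties_for_sort)
    then have "sizes K X ! i = rev ds ! i" by simp
    then show "card (X i) = ds ! (K - Suc i)" using i assms(3) by (simp add: sizes_def rev_nth)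
  }
  {
    assume *: "\<And>i. Suc i < K \<Longrightarrow> card (X (Suc i)) \<le> card (X i)" and i: "i < K"
    have "sorted_wrt (\<ge>) (sizes K X)"
      using * by (auto simp: sorted_wrt_iff_nth_Suc_transp[OF transp_on_ge] sizes_def)
    then have "sorted (rev (sizes K X))" by (simp add: sorted_wrt_rev)
    then have "rev (sizes K X) = rev ds"
      using srt assms(1) by (metis mset_rev properties_for_sort)
    then have "sizes K X ! i = ds ! i" by simp
    then show "card (X i) = ds ! i" using i by (simp add: sizes_def)
  }
qed

section \<open>Rows and columns of tableaux\<close>

lemma filter_downset:
  assumes "\<And>i k. i \<le> k \<Longrightarrow> P k \<Longrightarrow> P i"
  shows "\<exists>m. filter P [0..<n] = [0..<m] \<and> (\<forall>i. i < m \<longleftrightarrow> i < n \<and> P i)"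
proof (induction n)
  case (Suc n)
  then obtain m where m: "filter P [0..<n] = [0..<m]" "\<forall>i. i < m \<longleftrightarrow> i < n \<and> P i" by blast
  show ?case
  proof (cases "P n")
    case True
    then have all: "P i" if "i \<le> n" for i using that assms by blast
    then have "m = n" using m(2) by (metis less_or_eq_imp_le linorder_neqE_nat order_less_irrefl)
    then show ?thesis using True m(1) all by (intro exI[of _ "Suc n"]) auto
  next
    case False
    then show ?thesis using m by (intro exI[of _ m]) (auto simp: less_Suc_eq)
  qed
qed (intro exI[of _ 0], simp)

lemma filter_upt_downset:
  assumes "\<And>i k. i \<le> k \<Longrightarrow> k < n \<Longrightarrow> P k \<Longrightarrow> P i"
  shows "filter P [0..<n] = [0..<length (filter P [0..<n])]"
    and "i < length (filter P [0..<n]) \<longleftrightarrow> i < n \<and> P i"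
proof -
  let ?Q = "\<lambda>i. i < n \<and> P i"
  have e: "filter ?Q [0..<n] = filter P [0..<n]" by (rule filter_cong) auto
  obtain m where "filter ?Q [0..<n] = [0..<m]" "\<forall>i. i < m \<longleftrightarrow> i < n \<and> ?Q i"
    using filter_downset[of ?Q n] assms by (metis order_le_less_trans)
  then show "filter P [0..<n] = [0..<length (filter P [0..<n])]"
    "i < length (filter P [0..<n]) \<longleftrightarrow> i < n \<and> P i" unfolding e by auto
qed

lemma filter_conv_nth: "filter P xs = map ((!) xs) (filter (\<lambda>i. P (xs ! i)) [0..<length xs])"
  by (metis (no_types, lifting) comp_apply filter_cong filter_map map_nth)

lemma concat_guard: "concat (map (\<lambda>i. if P i then [f i] else []) xs) = map f (filter P xs)"
  by (induction xs) auto

lemma partition_nth_mono: "is_partition lam \<Longrightarrow> i \<le> k \<Longrightarrow> k < length lam \<Longrightarrow> lam ! k \<le> lam ! i"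
  by (cases "i = k") (auto simp: is_partition_def sorted_wrt_iff_nth_less)

lemma length_conj_part: "length (conj_part lam) = (if lam = [] then 0 else hd lam)"
  by (simp add: conj_part_def)

lemma conj_part_nth:
  assumes "is_partition lam" "j < length (conj_part lam)"
  shows "conj_part lam ! j = length (filter (\<lambda>i. j < lam ! i) [0..<length lam])"
    and "i < conj_part lam ! j \<longleftrightarrow> i < length lam \<and> j < lam ! i"
proof -
  have "conj_part lam ! j = length (filter (\<lambda>x. j < x) lam)"
    using assms(2) unfolding conj_part_def by simp
  then show *: "conj_part lam ! j = length (filter (\<lambda>i. j < lam ! i) [0..<length lam])"
    by (subst (asm) filter_conv_nth) simp
  show "i < conj_part lam ! j \<longleftrightarrow> i < length lam \<and> j < lam ! i"
    unfolding * using partition_nth_mono[OF assms(1)] by (intro filter_upt_downset(2)) (meson order_less_le_trans)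
qed

lemma less_part_iff:
  assumes "is_partition lam" "i < length lam"
  shows "j < lam ! i \<longleftrightarrow> j < length (conj_part lam) \<and> i < conj_part lam ! j"
proof -
  have "lam ! i \<le> length (conj_part lam)"
    using partition_nth_mono[OF assms(1), of 0 i] assms(2) by (auto simp: length_conj_part hd_conv_nth)
  then show ?thesis using conj_part_nth(2)[OF assms(1), of j i] assms(2) by auto
qed

lemma conj_part_mono:
  assumes "is_partition lam" "j \<le> k" "k < length (conj_part lam)"
  shows "conj_part lam ! k \<le> conj_part lam ! j"
proof (rule ccontr)
  assume "\<not> ?thesis"
  then show False
    using conj_part_nth(2)[OF assms(1), of j "conj_part lam ! j"]
      conj_part_nth(2)[OF assms(1), of k "conj_part lam ! j"] assms by auto
qed

lemma conj_part_pos: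
  assumes "is_partition lam" "j < length (conj_part lam)"
  shows "0 < conj_part lam ! j"
  using conj_part_nth(2)[OF assms, of 0] assms(2) by (auto simp: length_conj_part hd_conv_nth split: if_splits)

section \<open>Transposing fillings of a given shape\<close>

definition columns :: "nat list \<Rightarrow> nat list list \<Rightarrow> nat list list" where
  "columns lam T = map (\<lambda>j. map (\<lambda>i. T ! i ! j) [0..<conj_part lam ! j]) [0..<length (conj_part lam)]"

definition rows :: "nat list \<Rightarrow> nat list list \<Rightarrow> nat list list" where
  "rows lam cs = map (\<lambda>i. map (\<lambda>j. cs ! j ! i) [0..<lam ! i]) [0..<length lam]"

lemma crw_columns:
  assumes "is_partition lam" "map length T = lam"
  shows "crw T = concat (map rev (columns lam T))"
proof -
  have len: "length T = length lam" "\<And>i. i < length lam \<Longrightarrow> length (T ! i) = lam ! i"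
    using assms(2) by auto
  have L: "(if T = [] then 0 else length (hd T)) = length (conj_part lam)"
    using assms(2) by (cases T) (auto simp: length_conj_part)
  have "map (\<lambda>i. T ! i ! j) (filter (\<lambda>i. j < length (T ! i)) [0..<length T])
      = map (\<lambda>i. T ! i ! j) [0..<conj_part lam ! j]" if "j < length (conj_part lam)" for j
  proof -
    have "filter (\<lambda>i. j < length (T ! i)) [0..<length T] = filter (\<lambda>i. j < lam ! i) [0..<length lam]"
      unfolding len(1) by (rule filter_cong) (auto simp: len(2))
    also have "\<dots> = [0..<conj_part lam ! j]"
      unfolding conj_part_nth(1)[OF assms(1) that] using partition_nth_mono[OF assms(1)]
      by (intro filter_upt_downset(1)) (meson order_less_le_trans)
    finally show ?thesis by simp
  qed
  then show ?thesis
    unfolding crw_def L columns_def concat_guard by (auto intro!: arg_cong[of _ _ concat])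
qed

lemma cols_to_rows_eq:
  assumes "is_partition lam" "map length cs = conj_part lam"
  shows "cols_to_rows cs = rows lam cs"
proof -
  have len: "length cs = length (conj_part lam)" "\<And>j. j < length cs \<Longrightarrow> length (cs ! j) = conj_part lam ! j"
    using assms(2) by (metis length_map, metis length_map nth_map)
  have L: "(if cs = [] then 0 else length (hd cs)) = length lam"
  proof (cases "lam = []")
    case True
    then show ?thesis using len by (simp add: length_conj_part)
  next
    case False
    then have pos: "0 < hd lam" using assms(1) by (auto simp: is_partition_def)
    then have "cs \<noteq> []" using len(1) False by (auto simp: length_conj_part)
    moreover from this have "hd cs = cs ! 0" by (rule hd_conv_nth)
    moreover have "conj_part lam ! 0 = length lam"
    proof -
      have "0 < length (conj_part lam)" using False pos by (simp add: length_conj_part)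
      then show ?thesis
        using conj_part_nth(1)[OF assms(1), of 0] assms(1) by (simp add: is_partition_def filter_id_conv)
    qed
    ultimately show ?thesis using len(2)[of 0] by simp
  qed
  have "map (\<lambda>c. c ! i) (filter (\<lambda>c. i < length c) cs) = map (\<lambda>j. cs ! j ! i) [0..<lam ! i]"
    if i: "i < length lam" for i
  proof -
    have "filter (\<lambda>j. i < length (cs ! j)) [0..<length cs] = [0..<lam ! i]"
    proof -
      have d: "i < length (cs ! j)" if "j \<le> k" "k < length cs" "i < length (cs ! k)" for j k
        using that conj_part_mono[OF assms(1), of j k] len by simp
      have "j < length (filter (\<lambda>j. i < length (cs ! j)) [0..<length cs]) \<longleftrightarrow> j < lam ! i" for j
        using filter_upt_downset(2)[of "length cs" "\<lambda>j. i < length (cs ! j)" j, OF d]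
          less_part_iff[OF assms(1) i, of j] len by auto
      then have "length (filter (\<lambda>j. i < length (cs ! j)) [0..<length cs]) = lam ! i"
        by (metis linorder_neqE_nat order_less_irrefl)
      then show ?thesis using filter_upt_downset(1)[of "length cs" "\<lambda>j. i < length (cs ! j)", OF d] by simp
    qed
    then show ?thesis by (subst filter_conv_nth) (simp add: comp_def)
  qed
  then show ?thesis
    unfolding cols_to_rows_def L rows_def concat_guard by auto
qed

lemma rows_columns:
  assumes "is_partition lam" "map length T = lam"
  shows "rows lam (columns lam T) = T"
proof (rule nth_equalityI)
  show "length (rows lam (columns lam T)) = length T" using assms(2) by (auto simp: rows_def)
  fix i assume "i < length (rows lam (columns lam T))"
  then have i: "i < length lam" by (simp add: rows_def)
  then have "length (T ! i) = lam ! i" using assms(2) by auto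
  then show "rows lam (columns lam T) ! i = T ! i"
    using i less_part_iff[OF assms(1) i] by (intro nth_equalityI) (auto simp: rows_def columns_def)
qed

lemma columns_rows:
  assumes "is_partition lam" "map length cs = conj_part lam"
  shows "columns lam (rows lam cs) = cs"
proof -
  have len: "length cs = length (conj_part lam)" "\<And>j. j < length cs \<Longrightarrow> length (cs ! j) = conj_part lam ! j"
    using assms(2) by (metis length_map, metis length_map nth_map)
  show ?thesis
  proof (rule nth_equalityI)
    show "length (columns lam (rows lam cs)) = length cs" using len by (simp add: columns_def)
    fix j assume "j < length (columns lam (rows lam cs))"
    then have j: "j < length (conj_part lam)" by (simp add: columns_def)
    show "columns lam (rows lam cs) ! j = cs ! j"
      using j len conj_part_nth(2)[OF assms(1) j]
      by (intro nth_equalityI) (auto simp: rows_def columns_def)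
  qed
qed

lemma pcount_set_sorted:
  assumes "sorted_wrt (<) c"
  shows "pcount (set c) y = int (card {i. i < length c \<and> c ! i < y})"
proof -
  have "set c \<inter> {..<y} = (!) c ` {i. i < length c \<and> c ! i < y}" by (auto simp: in_set_conv_nth)
  moreover have "inj_on ((!) c) {i. i < length c \<and> c ! i < y}"
    using assms by (auto simp: strict_sorted_iff inj_on_def nth_eq_iff_index_eq)
  ultimately show ?thesis by (simp add: pcount_def card_image)
qed

text \<open>This converts the weak increase along tableau rows into the fixed-point condition of
  \<open>opF\<close>, which compares counting functions.\<close>

lemma prefix_dom_iff:
  assumes "sorted_wrt (<) c" "sorted_wrt (<) c'"
  shows "(\<forall>y. pcount (set c') y \<le> pcount (set c) y) \<longleftrightarrow>
    length c' \<le> length c \<and> (\<forall>i<length c'. c ! i \<le> c' ! i)"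
proof
  assume R: "length c' \<le> length c \<and> (\<forall>i<length c'. c ! i \<le> c' ! i)"
  have "{i. i < length c' \<and> c' ! i < y} \<subseteq> {i. i < length c \<and> c ! i < y}" for y
    using R by (auto intro: order_le_less_trans)
  then have "card {i. i < length c' \<and> c' ! i < y} \<le> card {i. i < length c \<and> c ! i < y}" for y
    by (intro card_mono) auto
  then show "\<forall>y. pcount (set c') y \<le> pcount (set c) y" using assms by (simp add: pcount_set_sorted)
next
  assume L: "\<forall>y. pcount (set c') y \<le> pcount (set c) y"
  have *: "i < length c \<and> c ! i \<le> c' ! i" if i: "i < length c'" for i
  proof -
    \<comment> \<open>Below this threshold lie at least \<open>i + 1\<close> entries of
      \<open>c'\<close>, hence of \<open>c\<close>; if \<open>c ! i\<close> were larger or missing,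
      there could be at most \<open>i\<close>.\<close>
    let ?y = "Suc (c' ! i)"
    have "{..i} \<subseteq> {k. k < length c' \<and> c' ! k < ?y}"
    proof
      fix k assume "k \<in> {..i}"
      then show "k \<in> {k. k < length c' \<and> c' ! k < ?y}"
        using i assms(2) by (cases "k = i") (auto simp: sorted_wrt_iff_nth_less intro: less_SucI)
    qed
    then have "card {..i} \<le> card {k. k < length c' \<and> c' ! k < ?y}" by (intro card_mono) auto
    also have "\<dots> \<le> card {k. k < length c \<and> c ! k < ?y}"
      using L[rule_format, of ?y] assms by (simp add: pcount_set_sorted)
    finally have ge: "Suc i \<le> card {k. k < length c \<and> c ! k < ?y}" by simp
    show ?thesis
    proof (rule ccontr)
      assume n: "\<not> ?thesis"
      have "{k. k < length c \<and> c ! k < ?y} \<subseteq> {..<i}"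
      proof
        fix k assume k: "k \<in> {k. k < length c \<and> c ! k < ?y}"
        show "k \<in> {..<i}"
        proof (rule ccontr)
          assume "k \<notin> {..<i}"
          then have ik: "i \<le> k" by simp
          then have "i < length c" using k by auto
          moreover have "c ! i \<le> c ! k"
            using ik k assms(1) by (cases "i = k") (auto simp: sorted_wrt_iff_nth_less intro: less_imp_le)
          ultimately show False using n k by auto
        qed
      qed
      then have "card {k. k < length c \<and> c ! k < ?y} \<le> card {..<i}" by (intro card_mono) auto
      then show False using ge by simp
    qed
  qed
  have "length c' \<le> length c"
  proof (cases c')
    case (Cons a list)
    then show ?thesis using *[of "length list"] by simp
  qed simp
  then show "length c' \<le> length c \<and> (\<forall>i<length c'. c ! i \<le> c' ! i)" using * by blast
qed

text \<open>The columns of a semistandard tableau, read from right to left, are the states fixed by all \<open>opF\<close>.\<close>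

definition tableau_columns :: "nat list \<Rightarrow> nat \<Rightarrow> nat list list \<Rightarrow> bool" where
  "tableau_columns lam n cs \<longleftrightarrow> map length cs = conj_part lam \<and>
     (\<forall>c\<in>set cs. sorted_wrt (<) c \<and> set c \<subseteq> {1..n}) \<and>
     (\<forall>j. Suc j < length cs \<longrightarrow> (\<forall>y. pcount (set (cs ! Suc j)) y \<le> pcount (set (cs ! j)) y))"

lemma tableau_columns_columns:
  assumes "is_partition lam" "T \<in> SSYT lam n"
  shows "tableau_columns lam n (columns lam T)"
proof -
  let ?cs = "columns lam T"
  have T: "map length T = lam" "\<And>row. row \<in> set T \<Longrightarrow> sorted row \<and> set row \<subseteq> {1..n}"
    "\<And>i j. Suc i < length T \<Longrightarrow> j < length (T ! Suc i) \<Longrightarrow> T ! i ! j < T ! Suc i ! j"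
    using assms(2) by (auto simp: SSYT_def)
  have len: "length T = length lam" "\<And>i. i < length lam \<Longrightarrow> length (T ! i) = lam ! i"
    using T(1) by auto
  have lcs: "map length ?cs = conj_part lam" "length ?cs = length (conj_part lam)"
    by (auto simp: columns_def intro: nth_equalityI)
  have c: "sorted_wrt (<) (?cs ! j) \<and> set (?cs ! j) \<subseteq> {1..n}" if j: "j < length (conj_part lam)" for j
  proof
    note cp = conj_part_nth(2)[OF assms(1) j]
    have "T ! i ! j < T ! Suc i ! j" if "Suc i < conj_part lam ! j" for i
      using that cp[of "Suc i"] T(3)[of i j] len by simp
    then show "sorted_wrt (<) (?cs ! j)"
      unfolding sorted_wrt_iff_nth_Suc_transp[OF transp_on_less]
      using j by (simp add: columns_def)
    have "T ! i ! j \<in> {1..n}" if "i < conj_part lam ! j" for i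
      using that cp T(2)[of "T ! i"] len nth_mem[of i T] nth_mem[of j "T ! i"] by fastforce
    then show "set (?cs ! j) \<subseteq> {1..n}" using j by (auto simp: columns_def)
  qed
  have "\<forall>y. pcount (set (?cs ! Suc j)) y \<le> pcount (set (?cs ! j)) y" if j: "Suc j < length (conj_part lam)" for j
  proof -
    have "T ! i ! j \<le> T ! i ! Suc j" if "i < conj_part lam ! Suc j" for i
    proof -
      have i: "i < length lam" "Suc j < lam ! i" using conj_part_nth(2)[OF assms(1) j, of i] that by auto
      then have "sorted (T ! i)" using T(2)[of "T ! i"] len by simp
      then show ?thesis using i len by (simp add: sorted_iff_nth_mono)
    qed
    then show ?thesis
      using j c conj_part_mono[OF assms(1), of j "Suc j"]
      by (subst prefix_dom_iff) (auto simp: columns_def)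
  qed
  moreover have "sorted_wrt (<) d \<and> set d \<subseteq> {1..n}" if "d \<in> set ?cs" for d
    using that c lcs(2) by (metis in_set_conv_nth)
  ultimately show ?thesis unfolding tableau_columns_def using lcs by simp
qed

lemma rows_in_SSYT:
  assumes "is_partition lam" "tableau_columns lam n cs"
  shows "rows lam cs \<in> SSYT lam n"
proof -
  have ml: "map length cs = conj_part lam"
    and cs: "\<And>c. c \<in> set cs \<Longrightarrow> sorted_wrt (<) c \<and> set c \<subseteq> {1..n}"
    and dom: "\<And>j y. Suc j < length cs \<Longrightarrow> pcount (set (cs ! Suc j)) y \<le> pcount (set (cs ! j)) y"
    using assms(2) by (auto simp: tableau_columns_def)
  have len: "length cs = length (conj_part lam)" "\<And>j. j < length cs \<Longrightarrow> length (cs ! j) = conj_part lam ! j"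
    using ml by (metis length_map, metis length_map nth_map)
  have lp: "j < length cs \<and> i < length (cs ! j)" if "i < length lam" "j < lam ! i" for i j
    using less_part_iff[OF assms(1) that(1), of j] that(2) len by auto
  have 1: "map length (rows lam cs) = lam" by (auto simp: rows_def intro: nth_equalityI)
  have 2: "sorted (rows lam cs ! i) \<and> set (rows lam cs ! i) \<subseteq> {1..n}" if i: "i < length lam" for i
  proof
    have "cs ! j ! i \<le> cs ! Suc j ! i" if "Suc j < lam ! i" for j
    proof -
      have l: "Suc j < length cs" "i < length (cs ! Suc j)" using lp[OF i that] by auto
      then have "j < length cs" by simp
      then have "sorted_wrt (<) (cs ! j)" "sorted_wrt (<) (cs ! Suc j)" using cs l(1) by auto
      from prefix_dom_iff[OF this] dom[OF l(1)] l(2) show ?thesis by blast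
    qed
    then show "sorted (rows lam cs ! i)" using i by (auto simp: rows_def sorted_iff_nth_Suc)
    show "set (rows lam cs ! i) \<subseteq> {1..n}"
    proof
      fix x assume "x \<in> set (rows lam cs ! i)"
      then obtain j where j: "j < lam ! i" "x = cs ! j ! i" using i by (auto simp: rows_def)
      then have "x \<in> set (cs ! j)" "cs ! j \<in> set cs" using lp[OF i j(1)] by auto
      then show "x \<in> {1..n}" using cs by blast
    qed
  qed
  have 3: "rows lam cs ! i ! j < rows lam cs ! Suc i ! j"
    if i: "Suc i < length lam" and "j < length (rows lam cs ! Suc i)" for i j
  proof -
    have j: "j < lam ! Suc i" using that by (simp add: rows_def)
    then have j': "j < lam ! i" using partition_nth_mono[OF assms(1), of i "Suc i"] i by simp
    have "sorted_wrt (<) (cs ! j)" "Suc i < length (cs ! j)" using lp[OF i j] cs by auto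
    then have "cs ! j ! i < cs ! j ! Suc i" by (simp add: sorted_wrt_iff_nth_less)
    then show ?thesis using i j j' by (simp add: rows_def)
  qed
  have lr: "length (rows lam cs) = length lam" by (simp add: rows_def)
  have "sorted row \<and> set row \<subseteq> {1..n}" if "row \<in> set (rows lam cs)" for row
    using that 2 lr by (metis in_set_conv_nth)
  then show ?thesis
    unfolding SSYT_def using 1 3 lr by simp
qed

section \<open>The bijection\<close>

text \<open>The reversed column word visits the columns from right to left, each from bottom to top
  and therefore increasingly, just as a queue with these columns as its rows is read.\<close>

lemma revcrw_eq_rw:
  assumes "is_partition lam" "map length T = lam" "\<forall>c\<in>set (columns lam T). sorted_wrt (<) c"
  shows "revcrw T = rw (rev (map set (columns lam T)))"
proof -
  have "sorted_list_of_set (set c) = c" if "c \<in> set (columns lam T)" for c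
    using that assms(3) strict_sorted_iff by (intro sorted_list_of_set.idem_if_sorted_distinct) auto
  then have "map (sorted_list_of_set \<circ> set) (rev (columns lam T)) = rev (columns lam T)"
    by (intro map_idI) auto
  then have "rw (rev (map set (columns lam T))) = concat (rev (columns lam T))"
    by (simp add: rw_def rev_map)
  then show ?thesis
    by (simp add: revcrw_def crw_columns[OF assms(1,2)] rev_concat rev_map comp_def)
qed

lemma st_map_upt: "\<forall>i\<ge>L. X i = {} \<Longrightarrow> st (map X [0..<L]) = X"
  by (rule ext) (auto simp: st_def)

theorem theoremA4:
  fixes lam :: "nat list" and n :: nat
  assumes "is_partition lam" and "length lam \<le> n"
  shows "(\<forall>T\<in>SSYT lam n. mlq T \<in> MLQ0 lam n)
       \<and> (\<forall>M\<in>MLQ0 lam n. tab M \<in> SSYT lam n)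
       \<and> (\<forall>T\<in>SSYT lam n. tab (mlq T) = T)
       \<and> (\<forall>M\<in>MLQ0 lam n. mlq (tab M) = M)"
proof -
  define L where "L = length (conj_part lam)"
  \<comment> \<open>\<open>L\<close> rows have \<open>L - 1\<close> neighbouring pairs, hence as
    many generators. The width is \<open>Suc n\<close> because the columns of balls are numbered
    from 1 to \<open>n\<close>.\<close>
  define m where "m = L - 1"
  let ?N = "Suc n"
  have Lm: "Suc i < L \<longleftrightarrow> i < m" for i by (auto simp: m_def)
  have cp_sorted: "sorted_wrt (\<ge>) (conj_part lam)"
    using conj_part_mono[OF assms(1)] by (auto simp: sorted_wrt_iff_nth_less)
  have cp_pos: "0 < conj_part lam ! i" if "i < L" for i
    using conj_part_pos[OF assms(1)] that by (simp add: L_def)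
  interpret E: zero_hecke opE "bdd_states ?N" by (rule zero_hecke_E)
  interpret F: zero_hecke opF "bdd_states ?N" by (rule zero_hecke_F)

  \<comment> \<open>Membership in \<open>bdd_states ?N\<close> would admit column 0, so confinement
    to \<open>{1..n}\<close> is tracked separately; balls only change rows.\<close>
  have subset_longest: "longest opE m X i \<subseteq> {1..n} \<and> longest opF m X i \<subseteq> {1..n}"
    if "\<And>i. X i \<subseteq> {1..n}" for X i
  proof -
    have E: "opE i X k \<subseteq> {1..n}" if "\<And>i. X i \<subseteq> {1..n}" for X :: "nat \<Rightarrow> nat set" and i k
      using that E_subset[of "X i" "{1..n}" "X (Suc i)"] by (auto simp: act_def)
    have F: "opF i X k \<subseteq> {1..n}" if "\<And>i. X i \<subseteq> {1..n}" for X :: "nat \<Rightarrow> nat set" and i k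
      using that F_subset[of "X i" "{1..n}" "X (Suc i)"] by (auto simp: act_def)
    have c: "chain f j X k \<subseteq> {1..n}"
      if "\<And>i X k. (\<And>i. X i \<subseteq> {1..n}) \<Longrightarrow> f i X k \<subseteq> {1..n}" "\<And>i. X i \<subseteq> {1..n}"
      for f :: "nat \<Rightarrow> (nat \<Rightarrow> nat set) \<Rightarrow> nat \<Rightarrow> nat set" and j X k
      using that(2)
    proof (induction j arbitrary: X)
      case 0
      then show ?case using that(1)[of X 0 k] by simp
    next
      case (Suc j)
      have "\<And>i. f (Suc j) X i \<subseteq> {1..n}" by (rule that(1)) (rule Suc.prems)
      then show ?case using Suc.IH[of "f (Suc j) X"] by simp
    qed
    have l: "longest f j X k \<subseteq> {1..n}"
      if "\<And>i X k. (\<And>i. X i \<subseteq> {1..n}) \<Longrightarrow> f i X k \<subseteq> {1..n}"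
      for f :: "nat \<Rightarrow> (nat \<Rightarrow> nat set) \<Rightarrow> nat \<Rightarrow> nat set" and j k
    proof (induction j arbitrary: k)
      case 0
      then show ?case using \<open>\<And>i. X i \<subseteq> {1..n}\<close> by simp
    next
      case (Suc j)
      show ?case unfolding longest.simps by (rule c) (rule that, assumption, rule Suc.IH)
    qed
    show ?thesis using l[of opE] l[of opF] E F by blast
  qed
  have bdd: "X \<in> bdd_states ?N" if "\<And>i. X i \<subseteq> {1..n}" for X
    unfolding bdd_states_def using that by fastforce

  \<comment> \<open>\<open>X\<close> is the state of a multiline queue of major index 0, \<open>Y\<close> that of the columns of a tableau.\<close>
  define pair where "pair = (\<lambda>X Y :: nat \<Rightarrow> nat set. (\<forall>i. X i \<subseteq> {1..n}) \<and> (\<forall>i. Y i \<subseteq> {1..n}) \<and>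
     (\<forall>i\<ge>L. X i = {}) \<and> (\<forall>i\<ge>L. Y i = {}) \<and> longest opF m X = Y \<and> longest opE m Y = X \<and>
     (\<forall>i<L. card (X i) = conj_part lam ! i) \<and> (\<forall>i<L. card (Y i) = conj_part lam ! (L - Suc i)))"
  have pair_bdd: "X \<in> bdd_states ?N" "Y \<in> bdd_states ?N" if "pair X Y" for X Y
    using that bdd by (auto simp: pair_def)
  have E_card: "card (X (Suc i)) \<le> card (X i)" if "opE i X = X" "X \<in> bdd_states ?N" for X i
    using that unm_open_empty_iff[of "X i" ?N "X (Suc i)"] suffix_dom_card
    by (auto simp: opE_fix bdd_states_def)
  have F_card: "card (X i) \<le> card (X (Suc i))" if "opF i X = X" "X \<in> bdd_states ?N" for X i
  proof -
    have "X i \<subseteq> {..<?N}" "X (Suc i) \<subseteq> {..<?N}" using that(2) by (auto simp: bdd_states_def)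
    moreover from this have "finite (X i)" "finite (X (Suc i))" using finite_subset by blast+
    moreover have "pcount (X i) ?N \<le> pcount (X (Suc i)) ?N" using that(1) opF_fix by blast
    ultimately show ?thesis by (simp add: pcount_eq_card[of _ ?N ?N])
  qed
  have ms: "mset (sizes L X) = mset (sizes L Y)"
    if "X \<in> bdd_states ?N" "Y \<in> bdd_states ?N" "longest opF m X = Y" "longest opE m Y = X" for X Y
  proof (cases "L = 0")
    case False
    then show ?thesis using mset_sizes[OF that(1,2) _ that(3,4), of L] by (simp add: m_def)
  qed (simp add: sizes_def)

  have pair_of_MLQ0: "pair (st M) (longest opF m (st M))" if "M \<in> MLQ0 lam n" for M
  proof -
    let ?X = "st M" and ?Y = "longest opF m (st M)"
    have M: "length M = L" "\<And>r. r < L \<Longrightarrow> M ! r \<subseteq> {1..n} \<and> card (M ! r) = conj_part lam ! r" "maj M = 0"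
      using that by (auto simp: MLQ0_def MLQ_def L_def)
    have X: "?X i \<subseteq> {1..n}" for i using M by (auto simp: st_def)
    have Xb: "?X \<in> bdd_states ?N" using bdd X by blast
    have fin: "\<forall>B\<in>set M. finite B"
      using M(1,2) by (metis finite_atLeastAtMost finite_subset in_set_conv_nth)
    have "card (M ! Suc i) \<le> card (M ! i)" if "Suc i < length M" for i
      using that M conj_part_mono[OF assms(1), of i "Suc i"] by (simp add: L_def)
    then have dom: "suffix_dom (M ! i) (M ! Suc i)" if "Suc i < L" for i
      using maj_eq_0_iff[OF fin] M(1,3) that by blast
    have fixed: "opE i ?X = ?X" if "i < m" for i
    proof -
      have i: "Suc i < L" using that Lm by simp
      then have "suffix_dom (?X i) (?X (Suc i))" using dom M(1) by (simp add: st_def)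
      then show ?thesis
        using Xb unm_open_empty_iff[of "?X i" ?N "?X (Suc i)"] by (simp add: opE_fix bdd_states_def)
    qed
    \<comment> \<open>Absorption reduces the left side to \<open>longest opE m ?X\<close>, and every
      generator already fixes \<open>?X\<close>.\<close>
    have E: "longest opE m ?Y = ?X"
      using longest_E_F[OF Xb, of m] E.longest_fix[of m ?X] fixed by simp
    have Y: "?Y i \<subseteq> {1..n}" for i using subset_longest[of ?X] X by blast
    have Yb: "?Y \<in> bdd_states ?N" using bdd Y by blast
    have out: "?Y i = {}" if "i \<ge> L" for i
      using that M(1) by (cases "L = 0") (auto simp: longest_act_beyond m_def st_def)
    have "map (\<lambda>i. card (?X i)) [0..<L] = conj_part lam"
      using M by (intro nth_equalityI) (auto simp: L_def st_def)
    then have mset: "mset (sizes L ?Y) = mset (conj_part lam)"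
      using ms[OF Xb Yb refl E] by (simp add: sizes_def)
    \<comment> \<open>All \<open>opF i\<close> with \<open>i < m\<close> fix \<open>?Y\<close>, so
      its sizes increase and the parts of the conjugate partition appear in reverse order.\<close>
    have "card (?Y i) \<le> card (?Y (Suc i))" if "Suc i < L" for i
      using F_card[OF F.longest_absorb_left[OF Xb, of i m] Yb] that Lm by simp
    then have "card (?Y i) = conj_part lam ! (L - Suc i)" if "i < L" for i
      using sizes_eqI(1)[OF mset cp_sorted, of i] that by (simp add: L_def)
    then show ?thesis
      unfolding pair_def using X Y out E M by (auto simp: st_def)
  qed

  have MLQ0_of_pair: "map X [0..<L] \<in> MLQ0 lam n" "strip_top R = map X [0..<L]"
    if p: "pair X Y" and R: "st R = X" for X Y R
  proof -
    have X: "\<And>i. X i \<subseteq> {1..n}" "\<And>i. i < L \<Longrightarrow> card (X i) = conj_part lam ! i"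
      "\<And>i. i \<ge> L \<Longrightarrow> X i = {}" "longest opE m Y = X"
      using p by (auto simp: pair_def)
    let ?M = "map X [0..<L]"
    have "suffix_dom (X i) (X (Suc i))" if "Suc i < L" for i
    proof -
      have "opE i X = X" using E.longest_absorb_left[OF pair_bdd(2)[OF p], of i m] that Lm X(4) by simp
      then show ?thesis
        using pair_bdd(1)[OF p] unm_open_empty_iff[of "X i" ?N "X (Suc i)"]
        by (simp add: opE_fix bdd_states_def)
    qed
    then have dom: "suffix_dom (?M ! i) (?M ! Suc i)" if "Suc i < length ?M" for i using that by simp
    have "finite (X i)" for i using X(1) by (rule finite_subset) simp
    then have "\<forall>B\<in>set ?M. finite B" by auto
    from maj_eq_0_iff[OF this suffix_dom_card[OF dom]] have "maj ?M = 0" using dom by blast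
    then show "?M \<in> MLQ0 lam n" using X by (auto simp: MLQ0_def MLQ_def L_def[symmetric])
    \<comment> \<open>The parts of the conjugate partition are positive, so stripping empty top rows
      stops exactly at height \<open>L\<close>.\<close>
    have "X i \<noteq> {}" if "i < L" for i using X(2)[OF that] cp_pos[OF that] by auto
    then show "strip_top R = ?M"
      using R st_map_upt[of L X] X(3) by (intro strip_top_eq) auto
  qed

  \<comment> \<open>Insertion leaves column \<open>i\<close> at index
    \<open>L - Suc i\<close>.\<close>
  define cols where "cols = (\<lambda>Y :: nat \<Rightarrow> nat set. map (\<lambda>i. sorted_list_of_set (Y (L - Suc i))) [0..<L])"
  have tab_of_pair: "tab M = rows lam (cols Y)" "tableau_columns lam n (cols Y)"
    if p: "pair (st M) Y" and M: "length M = L" for M Y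
  proof -
    have Y: "\<And>i. Y i \<subseteq> {1..n}" "\<And>i. i < L \<Longrightarrow> card (Y i) = conj_part lam ! (L - Suc i)"
      "longest opF m (st M) = Y" "\<And>i. st M i \<subseteq> {1..n}"
      using p by (auto simp: pair_def)
    have finY: "finite (Y i)" for i using Y(1) finite_subset by blast
    have ml: "map length (cols Y) = conj_part lam"
      using Y(2) by (intro nth_equalityI) (auto simp: cols_def L_def[symmetric])
    have fin: "\<forall>B\<in>set M. finite B"
    proof
      fix B assume "B \<in> set M"
      then obtain i where "i < length M" "B = M ! i" by (metis in_set_conv_nth)
      then have "B = st M i" by (simp add: st_def)
      then show "finite B" using finite_subset[OF Y(4)[of i]] by simp
    qed
    have ne: "longest opF (length M - 1) (st M) i \<noteq> {}" if "i < length M" for i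
    proof -
      have i: "i < L" "L - Suc i < L" using that M by auto
      have "card (Y i) \<noteq> 0" using Y(2)[OF i(1)] cp_pos[OF i(2)] by simp
      then have "Y i \<noteq> {}" by (metis card.empty)
      then show ?thesis using Y(3) M by (simp add: m_def)
    qed
    have "tab M = cols_to_rows (cols Y)"
      using tab_columns[OF fin, OF ne] unfolding M m_def[symmetric] Y(3) cols_def by blast
    then show "tab M = rows lam (cols Y)" using cols_to_rows_eq[OF assms(1) ml] by simp
    have domY: "pcount (Y i) y \<le> pcount (Y (Suc i)) y" if "Suc i < L" for i y
    proof -
      have "opF i Y = Y"
        using F.longest_absorb_left[OF pair_bdd(1)[OF p], of i m] that unfolding Lm Y(3) by blast
      then show ?thesis unfolding opF_fix by blast
    qed
    have domc: "pcount (set (cols Y ! Suc j)) y \<le> pcount (set (cols Y ! j)) y" if "Suc j < L" for j y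
    proof -
      have "Suc (L - Suc (Suc j)) = L - Suc j" using that by simp
      then show ?thesis
        using domY[of "L - Suc (Suc j)" y] that finY by (simp add: cols_def)
    qed
    have "sorted_wrt (<) c \<and> set c \<subseteq> {1..n}" if "c \<in> set (cols Y)" for c
    proof -
      obtain i where "c = sorted_list_of_set (Y i)" using \<open>c \<in> set (cols Y)\<close> by (auto simp: cols_def)
      then show ?thesis using finY Y(1) by simp
    qed
    moreover have "length (cols Y) = L" by (simp add: cols_def)
    ultimately show "tableau_columns lam n (cols Y)"
      unfolding tableau_columns_def using ml domc by simp
  qed

  have mlq_of_pair: "st (rho (revcrw T)) = X"
    if p: "pair X Y" and T: "map length T = lam" "columns lam T = cols Y" for X Y T
  proof -
    have Y: "\<And>i. i < L \<Longrightarrow> card (Y i) = conj_part lam ! (L - Suc i)" "\<And>i. i \<ge> L \<Longrightarrow> Y i = {}"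
      "longest opE m Y = X" "\<And>i. Y i \<subseteq> {1..n}"
      using p by (auto simp: pair_def)
    have finY: "finite (Y i)" for i using Y(4) finite_subset by blast
    \<comment> \<open>The reversal built into \<open>cols\<close> cancels the right-to-left reading,
      so the reading word is the row word of the state \<open>Y\<close> itself.\<close>
    have "rev (map set (cols Y)) = map Y [0..<L]"
      using finY by (intro nth_equalityI) (auto simp: cols_def rev_nth)
    moreover have "\<forall>c\<in>set (columns lam T). sorted_wrt (<) c" unfolding T(2) by (auto simp: cols_def)
    ultimately have rw: "revcrw T = rw (map Y [0..<L])"
      using revcrw_eq_rw[OF assms(1) T(1)] T(2) by simp
    have "Y i \<noteq> {}" if "i < L" for i
      using Y(1)[OF that] cp_pos[of "L - Suc i"] that by auto
    then have "st (rho (rw (map Y [0..<L]))) = longest opE (length (map Y [0..<L]) - 1) (st (map Y [0..<L]))"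
      using st_map_upt[of L Y] Y(2) pair_bdd(2)[OF p] by (intro st_rho_rw[of _ ?N]) auto
    then show ?thesis using st_map_upt[of L Y] Y(2,3) rw by (simp add: m_def)
  qed

  have pair_of_SSYT: "\<exists>X Y. pair X Y \<and> columns lam T = cols Y" if T: "T \<in> SSYT lam n" for T
  proof -
    let ?cs = "columns lam T"
    have tc: "tableau_columns lam n ?cs" using tableau_columns_columns[OF assms(1) T] .
    then have ml: "map length ?cs = conj_part lam" and c: "\<And>c. c \<in> set ?cs \<Longrightarrow> sorted_wrt (<) c \<and> set c \<subseteq> {1..n}"
      and dom: "\<And>j y. Suc j < length ?cs \<Longrightarrow> pcount (set (?cs ! Suc j)) y \<le> pcount (set (?cs ! j)) y"
      by (auto simp: tableau_columns_def)
    have len: "length ?cs = L" by (simp add: columns_def L_def)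
    define Y where "Y = st (rev (map set ?cs))"
    define X where "X = longest opE m Y"
    have Yi: "Y i = set (?cs ! (L - Suc i))" if "i < L" for i
      using that len by (simp add: Y_def st_def rev_nth)
    have Yout: "Y i = {}" if "i \<ge> L" for i using that len by (simp add: Y_def st_def)
    have Y: "Y i \<subseteq> {1..n}" for i
      using c[of "?cs ! (L - Suc i)"] len Yi[of i] Yout[of i] by (cases "i < L") auto
    have Yb: "Y \<in> bdd_states ?N" using bdd Y by blast
    have fixed: "opF i Y = Y" if "i < m" for i
    proof -
      have i: "Suc i < L" using that Lm by simp
      then have "Suc (L - Suc (Suc i)) = L - Suc i" by simp
      then show ?thesis
        unfolding opF_fix using dom[of "L - Suc (Suc i)"] i len Yi[of i] Yi[of "Suc i"] by simp
    qed
    have F: "longest opF m X = Y"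
      using longest_F_E[OF Yb, of m] F.longest_fix[of m Y] fixed by (simp add: X_def)
    have Xs: "X i \<subseteq> {1..n}" for i using subset_longest[of Y] Y by (simp add: X_def)
    have Xb: "X \<in> bdd_states ?N" using bdd Xs by blast
    have Xout: "X i = {}" if "i \<ge> L" for i
      using that Yout by (cases "L = 0") (auto simp: X_def longest_act_beyond m_def)
    have ccs: "card (set (?cs ! i)) = conj_part lam ! i" if "i < L" for i
    proof -
      have "distinct (?cs ! i)" using c[of "?cs ! i"] that len strict_sorted_iff by auto
      moreover have "length (?cs ! i) = conj_part lam ! i" using ml that len nth_map[of i ?cs length] by simp
      ultimately show ?thesis by (simp add: distinct_card)
    qed
    then have cY: "card (Y i) = conj_part lam ! (L - Suc i)" if "i < L" for i
      using Yi[OF that] that by simp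
    have "map (\<lambda>i. card (Y i)) [0..<L] = rev (conj_part lam)"
      using cY by (intro nth_equalityI) (auto simp: L_def rev_nth)
    then have "mset (sizes L Y) = mset (conj_part lam)" by (simp add: sizes_def)
    then have mset: "mset (sizes L X) = mset (conj_part lam)" using ms[OF Xb Yb F] X_def by simp
    have "card (X (Suc i)) \<le> card (X i)" if "Suc i < L" for i
      using E_card[OF E.longest_absorb_left[OF Yb, of i m, folded X_def] Xb] that Lm by simp
    then have "card (X i) = conj_part lam ! i" if "i < L" for i
      using sizes_eqI(2)[OF mset cp_sorted, of i] that by (simp add: L_def)
    then have "pair X Y"
      unfolding pair_def using Xs Y Xout Yout F X_def[symmetric] cY by (intro conjI allI impI) assumption+
    moreover have "?cs = cols Y"
    proof (rule nth_equalityI)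
      fix i assume i: "i < length ?cs"
      then have "sorted_list_of_set (set (?cs ! i)) = ?cs ! i"
        using c[of "?cs ! i"] strict_sorted_iff by (intro sorted_list_of_set.idem_if_sorted_distinct) auto
      then show "?cs ! i = cols Y ! i" using i len Yi[of "L - Suc i"] by (simp add: cols_def)
    qed (simp add: len cols_def)
    ultimately show ?thesis by blast
  qed

  have SSYT_case: "mlq T \<in> MLQ0 lam n \<and> tab (mlq T) = T" if T: "T \<in> SSYT lam n" for T
  proof -
    have mT: "map length T = lam" using T by (simp add: SSYT_def)
    obtain X Y where XY: "pair X Y" "columns lam T = cols Y" using pair_of_SSYT[OF T] by blast
    have rho: "st (rho (revcrw T)) = X" using mlq_of_pair[OF XY(1) mT XY(2)] .
    have mlq: "mlq T = map X [0..<L]" "mlq T \<in> MLQ0 lam n"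
      using MLQ0_of_pair[OF XY(1) rho] by (auto simp: mlq_def)
    \<comment> \<open>Padding undoes the cut to \<open>L\<close> rows, so \<open>tab\<close> starts
      from the very state that \<open>rho\<close> produced.\<close>
    have "st (mlq T) = X" unfolding mlq(1) using XY(1) by (intro st_map_upt) (simp add: pair_def)
    then have "tab (mlq T) = rows lam (cols Y)"
      using tab_of_pair(1)[of "mlq T" Y] XY(1) mlq(1) by simp
    also have "\<dots> = T" using rows_columns[OF assms(1) mT] XY(2) by simp
    finally show ?thesis using mlq(2) by simp
  qed
  have MLQ_case: "tab M \<in> SSYT lam n \<and> mlq (tab M) = M" if M: "M \<in> MLQ0 lam n" for M
  proof -
    let ?Y = "longest opF m (st M)"
    have len: "length M = L" using M by (simp add: MLQ0_def MLQ_def L_def)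
    note p = pair_of_MLQ0[OF M]
    note tab = tab_of_pair[OF p len]
    have S: "tab M \<in> SSYT lam n" using tab rows_in_SSYT[OF assms(1)] by simp
    have "map length (cols ?Y) = conj_part lam" using tab(2) by (simp add: tableau_columns_def)
    then have "columns lam (tab M) = cols ?Y" using columns_rows[OF assms(1)] tab(1) by simp
    then have "st (rho (revcrw (tab M))) = st M"
      using mlq_of_pair[OF p] S by (simp add: SSYT_def)
    then have "mlq (tab M) = map (st M) [0..<L]"
      using MLQ0_of_pair(2)[OF p] by (simp add: mlq_def)
    also have "\<dots> = M" using len by (intro nth_equalityI) (auto simp: st_def)
    finally show ?thesis using S by simp
  qed
  show ?thesis using SSYT_case MLQ_case by blast
qed

end
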